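(* Let $z,\Delta,F$ be integer constants and let $(T,d,z,p)$ be a maintaining plan where $T=(V,E)$ is an unweighted tree with maximum degree $\Delta$. Let $f:E\to\mathbb{N}$ satisfy $f(e)\le F$ for each $e\in E$. Then there is a polynomial-time algorithm deciding whether an $L,c,t,f$-vehicle route on $T$ exists.
   Context: $p:E\to\{1,\dots,z\}$ are priorities, $d$ is the depot, all edge lengths are $1$. $T^s$ is the symmetric orientation of $T$ (each edge replaced by two opposite arcs). External parameters: maximum route length $L$; $f$ bounding traversal frequency; $t:\{1,\dots,z\}\times\mathbb{Z}^+\to\mathbb{Q}^+$; capacity $c\le1$. An $L,c,t,f$-vehicle route is a closed walk $w=(e_1,\dots,e_\ell)$ in $T^s$ starting and ending at $d$ in which each arc appears at least once and at most $f(e)$ times, the total length is at most $L$, for every edge $e$ the total length between the $i$-th and $(i+1)$-th traversals of $e$ is at most $t(p(e),i)L$, and the route visits $d$ within every sub-route of total length bigger than $cL$. *)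

theory Defs
  imports
    "Graph_Theory.Digraph_Component"
    "HOL-Computational_Algebra.Polynomial"
begin

section \<open>Polynomial time\<close>

text \<open>
  The model of computation is pure first-order Lisp on binary trees, i.e. Jones' language F
  (N. D. Jones, Computability and Complexity from a Programming Perspective) with several
  arguments per function.  Every evaluation step costs one unit.  A value is a pointer to an
  immutable cell, so each of the finitely many kinds of steps of a fixed program takes a bounded
  number of operations on a pointer machine, no matter how large the trees are that its values
  unfold to; conversely a Turing machine tape is a pair of lists and a Turing machine step takes
  boundedly many steps here.  Polynomial time in this model is therefore polynomial time on
  Turing machines.
\<close>

datatype sexp = NIL | Cell sexp sexp

datatype expr =
    Param nat
  | Nil_expr
  | Cons_expr expr expr
  | Car expr
  | Cdr expr
  | If_expr expr expr expr
  | Call nat "expr list"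

text \<open>The \<open>i\<close>-th entry of a program is the body of the \<open>i\<close>-th function.\<close>

type_synonym program = "expr list"

fun car :: "sexp \<Rightarrow> sexp" where
  "car NIL = NIL"
| "car (Cell a b) = a"

fun cdr :: "sexp \<Rightarrow> sexp" where
  "cdr NIL = NIL"
| "cdr (Cell a b) = b"

text \<open>
  \<open>eval P as e v n\<close>: under the argument values \<open>as\<close>, call-by-value evaluation of \<open>e\<close> ends with
  the value \<open>v\<close> after \<open>n\<close> steps.  A call of an undefined function has no value.
\<close>

inductive eval :: "program \<Rightarrow> sexp list \<Rightarrow> expr \<Rightarrow> sexp \<Rightarrow> nat \<Rightarrow> bool"
  and evals :: "program \<Rightarrow> sexp list \<Rightarrow> expr list \<Rightarrow> sexp list \<Rightarrow> nat \<Rightarrow> bool"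
  for P :: program
where
  eval_Param: "eval P as (Param i) (if i < length as then as ! i else NIL) 1"
| eval_Nil: "eval P as Nil_expr NIL 1"
| eval_Cons: "eval P as e1 v1 n1 \<Longrightarrow> eval P as e2 v2 n2 \<Longrightarrow>
    eval P as (Cons_expr e1 e2) (Cell v1 v2) (n1 + n2 + 1)"
| eval_Car: "eval P as e v n \<Longrightarrow> eval P as (Car e) (car v) (n + 1)"
| eval_Cdr: "eval P as e v n \<Longrightarrow> eval P as (Cdr e) (cdr v) (n + 1)"
| eval_If_then: "eval P as e v n \<Longrightarrow> v \<noteq> NIL \<Longrightarrow> eval P as e1 v1 n1 \<Longrightarrow>
    eval P as (If_expr e e1 e2) v1 (n + n1 + 1)"
| eval_If_else: "eval P as e NIL n \<Longrightarrow> eval P as e2 v2 n2 \<Longrightarrow>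
    eval P as (If_expr e e1 e2) v2 (n + n2 + 1)"
| eval_Call: "evals P as es vs n1 \<Longrightarrow> i < length P \<Longrightarrow> eval P vs (P ! i) v n2 \<Longrightarrow>
    eval P as (Call i es) v (n1 + n2 + 1)"
| evals_Nil: "evals P as [] [] 0"
| evals_Cons: "eval P as e v n1 \<Longrightarrow> evals P as es vs n2 \<Longrightarrow>
    evals P as (e # es) (v # vs) (n1 + n2)"

inductive_cases eval_ParamE: "eval P as (Param i) v n"
inductive_cases eval_NilE: "eval P as Nil_expr v n"
inductive_cases eval_ConsE: "eval P as (Cons_expr e1 e2) v n"
inductive_cases eval_CarE: "eval P as (Car e) v n"
inductive_cases eval_CdrE: "eval P as (Cdr e) v n"
inductive_cases eval_IfE: "eval P as (If_expr e e1 e2) v n"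
inductive_cases eval_CallE: "eval P as (Call i es) v n"
inductive_cases evals_NilE: "evals P as [] vs n"
inductive_cases evals_ConsE: "evals P as (e # es) vs n"

lemma eval_deterministic:
  "eval P as e v n \<Longrightarrow> eval P as e v' n' \<Longrightarrow> v = v' \<and> n = n'"
  "evals P as es vs n \<Longrightarrow> evals P as es vs' n' \<Longrightarrow> vs = vs' \<and> n = n'"
proof (induction arbitrary: v' n' and vs' n' rule: eval_evals.inducts)
  case (eval_Param as i)
  from eval_Param.prems show ?case by (rule eval_ParamE) simp
next
  case (eval_Nil as)
  from eval_Nil.prems show ?case by (rule eval_NilE) simp
next
  case (eval_Cons as e1 v1 n1 e2 v2 n2)
  from eval_Cons.prems show ?case by (rule eval_ConsE)
      (auto dest!: eval_Cons.IH(2) eval_Cons.IH(4))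
next
  case (eval_Car as e v n)
  from eval_Car.prems show ?case by (rule eval_CarE)
      (auto dest!: eval_Car.IH(2))
next
  case (eval_Cdr as e v n)
  from eval_Cdr.prems show ?case by (rule eval_CdrE)
      (auto dest!: eval_Cdr.IH(2))
next
  case (eval_If_then as e v n e1 v1 n1 e2)
  from eval_If_then.prems show ?case
    by (rule eval_IfE)
      (auto simp: eval_If_then.hyps dest!: eval_If_then.IH(2) eval_If_then.IH(4))
next
  case (eval_If_else as e n e2 v2 n2 e1)
  from eval_If_else.prems show ?case
    by (rule eval_IfE)
      (auto dest!: eval_If_else.IH(2) eval_If_else.IH(4))
next
  case (eval_Call as es vs n1 i v n2)
  from eval_Call.prems show ?case by (rule eval_CallE)
      (auto dest!: eval_Call.IH(2) eval_Call.IH(5))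
next
  case (evals_Nil as)
  from evals_Nil.prems show ?case by (rule evals_NilE) simp
next
  case (evals_Cons as e v n1 es vs n2)
  from evals_Cons.prems show ?case by (rule evals_ConsE)
      (auto dest!: evals_Cons.IH(2) evals_Cons.IH(4))
qed

definition runs :: "program \<Rightarrow> sexp \<Rightarrow> sexp \<Rightarrow> nat \<Rightarrow> bool" where
  "runs P x y n \<longleftrightarrow> eval P [x] (Call 0 [Param 0]) y n"

text \<open>
  A decision problem is a set of pairs of an input and its answer; the algorithm has to be correct
  and fast on these inputs.  The function \<open>size\<close> counts the cells of the input tree.
\<close>

definition poly_time_decidable :: "(sexp \<times> bool) set \<Rightarrow> bool" where
  "poly_time_decidable R \<longleftrightarrow>
     (\<exists>P. \<exists>q :: nat poly. \<forall>(x, b) \<in> R. \<exists>y n.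
        runs P x y n \<and> n \<le> poly q (size x) \<and> (y \<noteq> NIL \<longleftrightarrow> b))"


section \<open>Maintaining plans and vehicle routes\<close>

definition simple_graph :: "'v set \<Rightarrow> 'v set set \<Rightarrow> bool" where
  "simple_graph V E \<longleftrightarrow> finite V \<and> (\<forall>e\<in>E. e \<subseteq> V \<and> card e = 2)"

definition sym_orientation :: "'v set \<Rightarrow> 'v set set \<Rightarrow> ('v, 'v \<times> 'v) pre_digraph" where
  "sym_orientation V E = with_proj \<lparr>pverts = V, parcs = {(u, v). {u, v} \<in> E}\<rparr>"

text \<open>
  The notion \<open>tree\<close> of the digraph library forbids directed cycles, among them those of length 2,
  so it does not apply to symmetric orientations.  Cycles of the undirected graph are the directed
  cycles of length at least 3 of its symmetric orientation.
\<close>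

definition undirected_tree :: "'v set \<Rightarrow> 'v set set \<Rightarrow> bool" where
  "undirected_tree V E \<longleftrightarrow> simple_graph V E \<and> connected (sym_orientation V E) \<and>
     (\<nexists>C. pre_digraph.cycle (sym_orientation V E) C \<and> 3 \<le> length C)"

definition degree_in :: "'v set set \<Rightarrow> 'v \<Rightarrow> nat" where
  "degree_in E v = card {e \<in> E. v \<in> e}"

definition maintaining_plan ::
  "'v set \<Rightarrow> 'v set set \<Rightarrow> 'v \<Rightarrow> nat \<Rightarrow> ('v set \<Rightarrow> nat) \<Rightarrow> bool" where
  "maintaining_plan V E d z p \<longleftrightarrow> simple_graph V E \<and> d \<in> V \<and> (\<forall>e\<in>E. p e \<in> {1..z})"

fun edge_of :: "'v \<times> 'v \<Rightarrow> 'v set" where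
  "edge_of (u, v) = {u, v}"

text \<open>The positions in \<open>w\<close>, in increasing order, of the traversals of \<open>e\<close> in either direction.\<close>

definition traversals :: "('v \<times> 'v) list \<Rightarrow> 'v set \<Rightarrow> nat list" where
  "traversals w e = filter (\<lambda>j. edge_of (w ! j) = e) [0..<length w]"

text \<open>
  Edges have length 1, so the length of a walk is its number of arcs.  The length between two
  traversals is that of the part of \<open>w\<close> strictly between them; the bound \<open>t\<close> counts traversals
  from 1, list positions count from 0.
\<close>

definition vehicle_route ::
  "'v set \<Rightarrow> 'v set set \<Rightarrow> 'v \<Rightarrow> ('v set \<Rightarrow> nat) \<Rightarrow>
   rat \<Rightarrow> rat \<Rightarrow> (nat \<Rightarrow> nat \<Rightarrow> rat) \<Rightarrow> ('v set \<Rightarrow> nat) \<Rightarrow> ('v \<times> 'v) list \<Rightarrow> bool" where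
  "vehicle_route V E d p L c t f w \<longleftrightarrow>
     pre_digraph.awalk (sym_orientation V E) d w d \<and>
     (\<forall>a \<in> arcs (sym_orientation V E). 1 \<le> count_list w a \<and> count_list w a \<le> f (edge_of a)) \<and>
     of_nat (length w) \<le> L \<and>
     (\<forall>e\<in>E. \<forall>i. 1 \<le> i \<and> i < length (traversals w e) \<longrightarrow>
        of_nat (traversals w e ! i - traversals w e ! (i - 1) - 1) \<le> t (p e) i * L) \<and>
     (\<forall>xs s ys. w = xs @ s @ ys \<and> s \<noteq> [] \<and> of_nat (length s) > c * L \<longrightarrow>
        (\<exists>a \<in> set s. d \<in> edge_of a))"


section \<open>Input encoding\<close>

text \<open>Numbers are written in binary, least significant bit first.\<close>

fun enc_nat :: "nat \<Rightarrow> sexp" where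
  "enc_nat n = (if n = 0 then NIL
     else Cell (if odd n then Cell NIL NIL else NIL) (enc_nat (n div 2)))"

declare enc_nat.simps [simp del]

definition enc_int :: "int \<Rightarrow> sexp" where
  "enc_int k = Cell (if k < 0 then Cell NIL NIL else NIL) (enc_nat (nat \<bar>k\<bar>))"

definition enc_rat :: "rat \<Rightarrow> sexp" where
  "enc_rat r = Cell (enc_int (fst (quotient_of r))) (enc_int (snd (quotient_of r)))"

definition enc_list :: "sexp list \<Rightarrow> sexp" where
  "enc_list xs = foldr Cell xs NIL"

text \<open>
  An encoding lists vertices and edges in an arbitrary order.  If \<open>f\<close> is bounded by \<open>F\<close>, then an
  edge is traversed at most \<open>2 * F\<close> times, so only the values \<open>t k i\<close> with \<open>1 \<le> k \<le> z\<close> and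
  \<open>1 \<le> i < 2 * F\<close> matter and \<open>t\<close> is given by the finite table of these.
\<close>

definition encodes ::
  "nat \<Rightarrow> nat \<Rightarrow> sexp \<Rightarrow> nat set \<Rightarrow> nat set set \<Rightarrow> nat \<Rightarrow> (nat set \<Rightarrow> nat) \<Rightarrow>
   rat \<Rightarrow> rat \<Rightarrow> (nat \<Rightarrow> nat \<Rightarrow> rat) \<Rightarrow> (nat set \<Rightarrow> nat) \<Rightarrow> bool" where
  "encodes z F x V E d p L c t f \<longleftrightarrow>
     (\<exists>vs es. distinct vs \<and> set vs = V \<and>
        distinct (map edge_of es) \<and> set (map edge_of es) = E \<and>
        x = enc_list
          [enc_list (map enc_nat vs),
           enc_list (map (\<lambda>(u, v). enc_list
             [enc_nat u, enc_nat v, enc_nat (p {u, v}), enc_nat (f {u, v})]) es),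
           enc_nat d,
           enc_rat L,
           enc_rat c,
           enc_list (map (\<lambda>k. enc_list (map (\<lambda>i. enc_rat (t k i)) [1..<2 * F])) [1..<z + 1])])"

end

theory Submission
  imports Defs
begin

text \<open>
  A walk that uses every arc at most \<open>F\<close> times has length at most \<open>2 * F * card E\<close>, and a vertex
  sees at most \<open>2 * F * \<Delta>\<close> of its steps.  So for each length there are only polynomially many
  possible views of the walk from a vertex.  All conditions on a route are conditions on single
  views, and views of all vertices come from a common walk as soon as those of neighbours agree on
  the edge between them: a step into a vertex determines the next step out of it.  On a tree, such
  a family of views exists if and only if no vertex loses all its views when, \<open>card V\<close> times,
  every view without an agreeing partner at some neighbour is discarded; a family is then chosen
  from the depot downwards.
\<close>

section \<open>Polynomial-time functions\<close>

subsection \<open>Polynomially bounded functions\<close>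

text \<open>The algorithm never roots the tree: a round treats all neighbours alike, and the root
  occurs only in the correctness proof. There the view of a vertex at depth \<open>k\<close> is
  taken among those that survive \<open>card V - k\<close> rounds. The last of these rounds supplies
  every child with an agreeing partner that survives one round fewer, and since all depths are below
  \<open>card V\<close> the supply of rounds does not run out. Acyclicity makes the choices
  independent, because each vertex has to agree with its parent only.

  \<open>L\<close> is written in binary and may be exponential in the size of the input, so the
  candidates for the length of the walk are taken from \<open>2 * F * card E\<close> instead, in
  unary. A vertex has at most \<open>2 * \<Delta>\<close> incident arcs with at most
  \<open>F\<close> uses each; views with \<open>2 * F * \<Delta>\<close> entries therefore suffice,
  and this constant governs the degree of the polynomial.\<close>

definition polyb :: "(sexp \<Rightarrow> nat) \<Rightarrow> bool" where
  "polyb b \<longleftrightarrow> (\<exists>k. \<forall>x. b x \<le> (size x + 2) ^ k)"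

lemma polyb_mono: "polyb b \<Longrightarrow> (\<And>x. a x \<le> b x) \<Longrightarrow> polyb a"
  unfolding polyb_def by (meson le_trans)

text \<open>The base \<open>size x + 2\<close> is at least 2, so constants can be absorbed into the
  exponent and a single power can stand for a polynomial.\<close>

lemma polyb_const: "polyb (\<lambda>_. c)"
proof -
  have "c \<le> (size x + 2) ^ c" for x :: sexp
  proof -
    have "c \<le> 2 ^ c" by (rule less_imp_le, rule less_exp)
    also have "(2::nat) ^ c \<le> (size x + 2) ^ c" by (rule power_mono) auto
    finally show ?thesis .
  qed
  then show ?thesis unfolding polyb_def by blast
qed

lemma polyb_size: "polyb size"
  unfolding polyb_def by (rule exI[of _ 1]) auto

lemma polyb_mult:
  assumes "polyb a" "polyb b"
  shows "polyb (\<lambda>x. a x * b x)"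
proof -
  from assms obtain k m where "\<And>x. a x \<le> (size x + 2) ^ k" "\<And>x. b x \<le> (size x + 2) ^ m"
    unfolding polyb_def by blast
  then have "a x * b x \<le> (size x + 2) ^ (k + m)" for x
    by (simp add: power_add mult_mono)
  then show ?thesis unfolding polyb_def by blast
qed

text \<open>By \<open>a + b \<le> (a + 1) * (b + 1)\<close> sums reduce to products; adding 1 costs
  one more factor of the base.\<close>

lemma polyb_add:
  assumes "polyb a" "polyb b"
  shows "polyb (\<lambda>x. a x + b x)"
proof -
  have "polyb (\<lambda>x. (a x + 1) * (b x + 1))"
  proof -
    have "polyb (\<lambda>x. c x + 1)" if c: "polyb c" for c
    proof -
      from c obtain k where k: "\<And>x. c x \<le> (size x + 2) ^ k"
        unfolding polyb_def by blast
      have "c x + 1 \<le> (size x + 2) ^ Suc k" for x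
      proof -
        have "c x + 1 \<le> (size x + 2) ^ k + (size x + 2) ^ k"
          using k[of x] by (intro add_mono) auto
        also have "\<dots> \<le> (size x + 2) ^ Suc k" by simp
        finally show ?thesis .
      qed
      then show ?thesis unfolding polyb_def by blast
    qed
    with assms show ?thesis by (intro polyb_mult)
  qed
  then show ?thesis by (rule polyb_mono) (simp add: algebra_simps)
qed

lemma polyb_power: "polyb a \<Longrightarrow> polyb (\<lambda>x. a x ^ k)"
  by (induction k) (simp_all add: polyb_const polyb_mult)

text \<open>The time of an outer function depends on the size of the inner value, not on the time
  taken to compute that value.\<close>

lemma polyb_comp:
  assumes "polyb t" "polyb (\<lambda>x. size (f x))"
  shows "polyb (\<lambda>x. t (f x))"
proof -
  from assms(1) obtain k where k: "\<And>x. t x \<le> (size x + 2) ^ k"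
    unfolding polyb_def by blast
  have "polyb (\<lambda>x. (size (f x) + 2) ^ k)"
    by (intro polyb_power polyb_add polyb_const assms)
  then show ?thesis by (rule polyb_mono) (rule k)
qed

lemmas polyb_intros = polyb_const polyb_size polyb_mult polyb_add polyb_power

text \<open>For loop bodies, which receive the context \<open>x\<close> paired with a list element:
  the bound \<open>c\<close> is uniform in the element, so it can be multiplied by the number of
  rounds.\<close>

lemma polyb_Cell_member:
  assumes b: "polyb b" and L: "polyb (\<lambda>x. size (L x))"
  shows "\<exists>c. polyb c \<and> (\<forall>x a. size a \<le> size (L x) \<longrightarrow> b (Cell x a) \<le> c x)"
proof -
  from b obtain k where k: "\<And>x. b x \<le> (size x + 2) ^ k"
    unfolding polyb_def by blast
  have "b (Cell x a) \<le> (size x + size (L x) + 3) ^ k" if "size a \<le> size (L x)" for x a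
  proof -
    have "b (Cell x a) \<le> (size (Cell x a) + 2) ^ k" by (rule k)
    also have "\<dots> \<le> (size x + size (L x) + 3) ^ k" using that by (intro power_mono) auto
    finally show ?thesis .
  qed
  moreover have "polyb (\<lambda>x. (size x + size (L x) + 3) ^ k)"
    by (intro polyb_intros L)
  ultimately show ?thesis by blast
qed


subsection \<open>Relocation of programs\<close>

text \<open>Calls are absolute indices, so placing a program behind \<open>k\<close> other functions
  adds \<open>k\<close> to each of them.\<close>

primrec shift :: "nat \<Rightarrow> expr \<Rightarrow> expr" where
  "shift k (Param i) = Param i"
| "shift k Nil_expr = Nil_expr"
| "shift k (Cons_expr a b) = Cons_expr (shift k a) (shift k b)"
| "shift k (Car a) = Car (shift k a)"
| "shift k (Cdr a) = Cdr (shift k a)"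
| "shift k (If_expr a b c) = If_expr (shift k a) (shift k b) (shift k c)"
| "shift k (Call i es) = Call (i + k) (map (shift k) es)"

lemma shift_0 [simp]: "shift 0 e = e"
  by (induction e) (auto intro: map_idI)

lemma eval_shift:
  "eval P as e v n \<Longrightarrow> eval (Q @ map (shift (length Q)) P @ R) as (shift (length Q) e) v n"
  "evals P as es vs n \<Longrightarrow>
    evals (Q @ map (shift (length Q)) P @ R) as (map (shift (length Q)) es) vs n"
proof (induction rule: eval_evals.inducts)
  case (eval_Call as es vs n1 i v n2)
  have "(Q @ map (shift (length Q)) P @ R) ! (i + length Q) = shift (length Q) (P ! i)"
    using eval_Call by (simp add: nth_append)
  then show ?case
    unfolding shift.simps by (intro eval_evals.eval_Call) (use eval_Call in simp_all)
qed (unfold shift.simps list.map, (rule eval_evals.intros; assumption)+)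

text \<open>Keeping the expression apart from the program lets several expressions share one
  program, as every combination of them requires.\<close>

definition computes :: "program \<Rightarrow> expr \<Rightarrow> (sexp \<Rightarrow> sexp) \<Rightarrow> bool" where
  "computes P e f \<longleftrightarrow> (\<exists>t. polyb t \<and> (\<forall>x. \<exists>n\<le>t x. eval P [x] e (f x) n))"

lemma computes_shift:
  "computes P e f \<Longrightarrow> computes (Q @ map (shift (length Q)) P @ R) (shift (length Q) e) f"
  unfolding computes_def by (meson eval_shift(1))

lemma computes_extend: "computes P e f \<Longrightarrow> computes (P @ R) e f"
  using computes_shift[of P e f "[]" R] by (simp add: map_idI)

text \<open>The bound on the size of the value does not follow from the bound on the time, because
  values share cells.\<close>

definition ptime :: "(sexp \<Rightarrow> sexp) \<Rightarrow> bool" where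
  "ptime f \<longleftrightarrow> (\<exists>P e. computes P e f) \<and> polyb (\<lambda>x. size (f x))"

lemma ptime_size: "ptime f \<Longrightarrow> polyb (\<lambda>x. size (f x))"
  by (simp add: ptime_def)

lemma ptimeI:
  assumes "polyb (\<lambda>x. size (f x))" "polyb t" "\<And>x. \<exists>n\<le>t x. eval P [x] e (f x) n"
  shows "ptime f"
  using assms unfolding ptime_def computes_def by blast

text \<open>The second program is appended with shifted calls, so the old expression
  \<open>e\<close> keeps its meaning.\<close>

lemma computes_common:
  assumes "ptime f" "computes P e g"
  shows "\<exists>R e'. computes (P @ R) e' f \<and> computes (P @ R) e g"
proof -
  from assms(1) obtain Q e' where "computes Q e' f" by (auto simp: ptime_def)
  from computes_shift[OF this, of P "[]"] computes_extend[OF assms(2)] show ?thesis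
    by auto
qed


subsection \<open>Closure properties\<close>

lemma ptime_id: "ptime (\<lambda>x. x)"
  by (rule ptimeI[of _ "\<lambda>_. 1" _ "Param 0"])
    (use eval_Param[of _ "[_]" 0] in \<open>auto intro: polyb_intros\<close>)

fun const_expr :: "sexp \<Rightarrow> expr" where
  "const_expr NIL = Nil_expr"
| "const_expr (Cell a b) = Cons_expr (const_expr a) (const_expr b)"

lemma ptime_const: "ptime (\<lambda>x. c)"
proof -
  have "\<exists>n. \<forall>x. eval [] [x] (const_expr c) c n"
  proof (induction c)
    case NIL
    show ?case by (auto intro: eval_evals.intros)
  next
    case (Cell a b)
    then show ?case by (auto intro: eval_evals.intros)
  qed
  then obtain n where "\<And>x. eval [] [x] (const_expr c) c n" by blast
  then show ?thesis by (intro ptimeI[of _ "\<lambda>_. n" "[]" "const_expr c"]) (auto intro: polyb_const)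
qed

lemma ptime_car_id: "ptime car"
proof (rule ptimeI[of _ "\<lambda>_. 2" _ "Car (Param 0)"])
  have "size (car x) \<le> size x" for x by (cases x) auto
  then show "polyb (\<lambda>x. size (car x))" by (rule polyb_mono[OF polyb_size])
  show "\<exists>n\<le>2. eval [] [x] (Car (Param 0)) (car x) n" for x
    using eval_Car[OF eval_Param[of "[]" "[x]" 0]] by (auto simp: numeral_2_eq_2)
qed (rule polyb_const)

lemma ptime_cdr_id: "ptime cdr"
proof (rule ptimeI[of _ "\<lambda>_. 2" _ "Cdr (Param 0)"])
  have "size (cdr x) \<le> size x" for x by (cases x) auto
  then show "polyb (\<lambda>x. size (cdr x))" by (rule polyb_mono[OF polyb_size])
  show "\<exists>n\<le>2. eval [] [x] (Cdr (Param 0)) (cdr x) n" for x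
    using eval_Cdr[OF eval_Param[of "[]" "[x]" 0]] by (auto simp: numeral_2_eq_2)
qed (rule polyb_const)

lemma ptime_Cell:
  assumes f: "ptime f" and g: "ptime g"
  shows "ptime (\<lambda>x. Cell (f x) (g x))"
proof -
  from g obtain P e where "computes P e g" by (auto simp: ptime_def)
  from computes_common[OF f this] obtain P e e' where
    "computes P e' f" "computes P e g" by blast
  then obtain t t' where t: "polyb t" "\<And>x. \<exists>n\<le>t x. eval P [x] e' (f x) n"
    and t': "polyb t'" "\<And>x. \<exists>n\<le>t' x. eval P [x] e (g x) n"
    unfolding computes_def by blast
  show ?thesis
  proof (rule ptimeI[of _ "\<lambda>x. t x + t' x + 1" P "Cons_expr e' e"])
    show "polyb (\<lambda>x. size (Cell (f x) (g x)))"
      unfolding sexp.size by (intro polyb_intros ptime_size f g)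
    show "polyb (\<lambda>x. t x + t' x + 1)" by (intro polyb_intros t t')
    fix x
    from t(2)[of x] t'(2)[of x] obtain n m where
      "n \<le> t x" "eval P [x] e' (f x) n" "m \<le> t' x" "eval P [x] e (g x) m" by blast
    then show "\<exists>n\<le>t x + t' x + 1. eval P [x] (Cons_expr e' e) (Cell (f x) (g x)) n"
      by (intro exI[of _ "n + m + 1"] conjI eval_Cons) simp_all
  qed
qed

lemma ptime_comp:
  assumes f: "ptime f" and g: "ptime g"
  shows "ptime (\<lambda>x. f (g x))"
proof -
  from g obtain P e where "computes P e g" by (auto simp: ptime_def)
  from computes_common[OF f this] obtain P e e' where
    "computes P e' f" "computes P e g" by blast
  from this[THEN computes_extend[where R = "[e']"]]
  obtain t t' where t: "polyb t" "\<And>x. \<exists>n\<le>t x. eval (P @ [e']) [x] e' (f x) n"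
    and t': "polyb t'" "\<And>x. \<exists>n\<le>t' x. eval (P @ [e']) [x] e (g x) n"
    unfolding computes_def by blast
  show ?thesis
  proof (rule ptimeI[of _ "\<lambda>x. t' x + t (g x) + 1" "P @ [e']" "Call (length P) [e]"])
    show "polyb (\<lambda>x. size (f (g x)))"
      by (rule polyb_comp[OF ptime_size[OF f] ptime_size[OF g]])
    show "polyb (\<lambda>x. t' x + t (g x) + 1)"
      by (intro polyb_intros t' polyb_comp[OF t(1)] ptime_size[OF g])
    fix x
    from t(2)[of "g x"] t'(2)[of x] obtain n m where
      n: "n \<le> t (g x)" "eval (P @ [e']) [g x] e' (f (g x)) n"
      and m: "m \<le> t' x" "eval (P @ [e']) [x] e (g x) m" by blast
    have "eval (P @ [e']) [x] (Call (length P) [e]) (f (g x)) (m + 0 + n + 1)"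
      by (rule eval_Call[OF evals_Cons[OF m(2) evals_Nil]]) (use n in simp_all)
    moreover have "m + 0 + n + 1 \<le> t' x + t (g x) + 1"
      using n m by simp
    ultimately show "\<exists>n\<le>t' x + t (g x) + 1. eval (P @ [e']) [x] (Call (length P) [e]) (f (g x)) n"
      by blast
  qed
qed

lemmas ptime_car = ptime_comp[OF ptime_car_id]
lemmas ptime_cdr = ptime_comp[OF ptime_cdr_id]

definition tt :: sexp where "tt = Cell NIL NIL"

lemma tt_neq_NIL [simp]: "tt \<noteq> NIL" "NIL \<noteq> tt"
  by (auto simp: tt_def)

definition pbool :: "(sexp \<Rightarrow> bool) \<Rightarrow> bool" where
  "pbool P \<longleftrightarrow> ptime (\<lambda>x. if P x then tt else NIL)"

lemma ptime_If_NIL: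
  assumes f: "ptime f" and g: "ptime g" and h: "ptime h"
  shows "ptime (\<lambda>x. if h x \<noteq> NIL then f x else g x)"
proof -
  from g obtain P e1 where "computes P e1 g" by (auto simp: ptime_def)
  from computes_common[OF f this] obtain P e1 e2 where
    fg: "computes P e1 g" "computes P e2 f" by blast
  from computes_common[OF h fg(1)] computes_extend[OF fg(2)]
  obtain P e1 e2 e3 where "computes P e1 g" "computes P e2 f" "computes P e3 h" by blast
  then obtain t1 t2 t3 where
      t1: "polyb t1" "\<And>x. \<exists>n\<le>t1 x. eval P [x] e1 (g x) n"
    and t2: "polyb t2" "\<And>x. \<exists>n\<le>t2 x. eval P [x] e2 (f x) n"
    and t3: "polyb t3" "\<And>x. \<exists>n\<le>t3 x. eval P [x] e3 (h x) n"
    unfolding computes_def by blast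
  show ?thesis
  proof (rule ptimeI[of _ "\<lambda>x. t3 x + t1 x + t2 x + 1" P "If_expr e3 e2 e1"])
    have "polyb (\<lambda>x. size (f x) + size (g x))" by (intro polyb_intros ptime_size f g)
    then show "polyb (\<lambda>x. size (if h x \<noteq> NIL then f x else g x))"
      by (rule polyb_mono) auto
    show "polyb (\<lambda>x. t3 x + t1 x + t2 x + 1)" by (intro polyb_intros t1 t2 t3)
    fix x
    from t1(2)[of x] t2(2)[of x] t3(2)[of x] obtain n1 n2 n3 where
      n: "n1 \<le> t1 x" "eval P [x] e1 (g x) n1" "n2 \<le> t2 x" "eval P [x] e2 (f x) n2"
        "n3 \<le> t3 x" "eval P [x] e3 (h x) n3" by blast
    show "\<exists>n\<le>t3 x + t1 x + t2 x + 1.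
      eval P [x] (If_expr e3 e2 e1) (if h x \<noteq> NIL then f x else g x) n"
    proof (cases "h x = NIL")
      case True
      with n show ?thesis
        using eval_If_else[of P "[x]" e3 n3 e1 "g x" n1 e2]
        by (intro exI[of _ "n3 + n1 + 1"]) simp
    next
      case False
      with n show ?thesis
        using eval_If_then[of P "[x]" e3 "h x" n3 e2 "f x" n2 e1]
        by (intro exI[of _ "n3 + n2 + 1"]) simp
    qed
  qed
qed

lemma ptime_If:
  assumes P: "pbool P" and f: "ptime f" and g: "ptime g"
  shows "ptime (\<lambda>x. if P x then f x else g x)"
proof -
  have eq: "(\<lambda>x. if (if P x then tt else NIL) \<noteq> NIL then f x else g x) =
    (\<lambda>x. if P x then f x else g x)"
    by (rule ext) simp
  show ?thesis
    by (rule ptime_If_NIL[OF f g P[unfolded pbool_def], unfolded eq])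
qed

lemma pbool_const: "pbool (\<lambda>_. b)"
  unfolding pbool_def by (rule ptime_const)

lemma pbool_comp: "pbool P \<Longrightarrow> ptime g \<Longrightarrow> pbool (\<lambda>x. P (g x))"
  unfolding pbool_def by (rule ptime_comp)

lemma pbool_If:
  assumes P: "pbool P" and f: "pbool f" and g: "pbool g"
  shows "pbool (\<lambda>x. if P x then f x else g x)"
proof -
  have eq: "(\<lambda>x. if P x then if f x then tt else NIL else if g x then tt else NIL) =
    (\<lambda>x. if if P x then f x else g x then tt else NIL)"
    by (rule ext) simp
  show ?thesis
    using ptime_If[OF P f[unfolded pbool_def] g[unfolded pbool_def]]
    by (simp only: pbool_def eq)
qed

section \<open>Lists and folds over them\<close>

fun lst :: "sexp \<Rightarrow> sexp list" where
  "lst NIL = []"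
| "lst (Cell a b) = a # lst b"

lemma enc_list_simps [simp]: "enc_list [] = NIL" "enc_list (x # xs) = Cell x (enc_list xs)"
  by (simp_all add: enc_list_def)

lemma lst_enc_list [simp]: "lst (enc_list xs) = xs"
  by (induction xs) auto

text \<open>Every tree is the list of left subtrees along its right spine. Thus \<open>lst\<close>
  and \<open>enc_list\<close> are inverse bijections, and list functions apply to arbitrary
  trees.\<close>

lemma enc_list_lst [simp]: "enc_list (lst x) = x"
  by (induction x) auto

lemma length_lst: "length (lst x) \<le> size x"
  by (induction x) auto

lemma length_le_size: "length xs \<le> size (enc_list xs)"
  by (induction xs) auto

lemma size_member: "a \<in> set xs \<Longrightarrow> size a \<le> size (enc_list xs)"
  by (induction xs) auto

lemma size_enc_list_append [simp]:
  "size (enc_list (xs @ ys)) = size (enc_list xs) + size (enc_list ys)"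
  by (induction xs) auto

text \<open>The body of function \<open>j\<close>, whose parameters are the context, the remaining
  list and the accumulator. The step function \<open>i\<close> has one parameter and receives the
  context, accumulator and element packed into a tree; this explains the projections
  \<open>car s\<close>, \<open>car (cdr s)\<close>, \<open>cdr (cdr s)\<close> in later
  hypotheses.\<close>

definition loop :: "nat \<Rightarrow> nat \<Rightarrow> expr" where
  "loop i j = If_expr (Param 1)
     (Call j [Param 0, Cdr (Param 1),
        Call i [Cons_expr (Param 0) (Cons_expr (Param 2) (Car (Param 1)))]])
     (Param 2)"

text \<open>The time \<open>T\<close> is demanded only for accumulators that really occur, because
  the time of a step may grow with the accumulator. The constants 20 and 5 generously cover the
  overhead of a round and of the exit.\<close>

lemma eval_loop:
  assumes i: "i < length P" and j: "j < length P" "P ! j = loop i j"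
    and step: "\<And>zs a ws. ys = zs @ a # ws \<Longrightarrow>
      \<exists>n\<le>T. eval P [Cell x (Cell (foldl f acc zs) a)] (P ! i) (f (foldl f acc zs) a) n"
  shows "\<exists>n\<le>length ys * (T + 20) + 5. eval P [x, enc_list ys, acc] (P ! j) (foldl f acc ys) n"
  using step
proof (induction ys arbitrary: acc)
  case Nil
  have "eval P [x, NIL, acc] (Param 1) NIL 1" "eval P [x, NIL, acc] (Param 2) acc 1"
    using eval_Param[of P "[x, NIL, acc]" 1] eval_Param[of P "[x, NIL, acc]" 2] by auto
  then have "eval P [x, NIL, acc] (loop i j) acc (1 + 1 + 1)"
    unfolding loop_def by (rule eval_If_else)
  then show ?case using j by (intro exI[of _ "1 + 1 + 1"]) auto
next
  case (Cons y ys)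
  define as where "as = [x, enc_list (y # ys), acc]"
  have p: "eval P as (Param 0) x 1" "eval P as (Param 1) (Cell y (enc_list ys)) 1"
    "eval P as (Param 2) acc 1"
    using eval_Param[of P as 0] eval_Param[of P as 1] eval_Param[of P as 2]
    by (auto simp: as_def)
  from Cons.prems[of "[]" y ys] obtain n where
    n: "n \<le> T" "eval P [Cell x (Cell acc y)] (P ! i) (f acc y) n" by auto
  have "\<exists>n\<le>length ys * (T + 20) + 5. eval P [x, enc_list ys, f acc y] (P ! j)
    (foldl f (f acc y) ys) n"
  proof (rule Cons.IH)
    fix zs a ws assume "ys = zs @ a # ws"
    then show "\<exists>n\<le>T. eval P [Cell x (Cell (foldl f (f acc y) zs) a)] (P ! i)
      (f (foldl f (f acc y) zs) a) n"
      using Cons.prems[of "y # zs" a ws] by simp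
  qed
  then obtain m where m: "m \<le> length ys * (T + 20) + 5"
    "eval P [x, enc_list ys, f acc y] (P ! j) (foldl f (f acc y) ys) m" by blast
  have "eval P as (Cons_expr (Param 0) (Cons_expr (Param 2) (Car (Param 1))))
    (Cell x (Cell acc y)) (1 + (1 + (1 + 1) + 1) + 1)"
    using eval_Cons[OF p(1) eval_Cons[OF p(3) eval_Car[OF p(2)]]] by simp
  from eval_Call[OF evals_Cons[OF this evals_Nil] i n(2)]
  have c: "eval P as (Call i [Cons_expr (Param 0) (Cons_expr (Param 2) (Car (Param 1)))])
    (f acc y) (1 + (1 + (1 + 1) + 1) + 1 + 0 + n + 1)" .
  have d: "eval P as (Cdr (Param 1)) (enc_list ys) (1 + 1)"
    using eval_Cdr[OF p(2)] by simp
  note e = eval_Call[OF evals_Cons[OF p(1) evals_Cons[OF d evals_Cons[OF c evals_Nil]]] j(1) m(2)]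
  have "eval P as (loop i j) (foldl f acc (y # ys))
    (1 + (1 + (1 + 1 + (1 + (1 + (1 + 1) + 1) + 1 + 0 + n + 1 + 0)) + m + 1) + 1)"
    unfolding loop_def using eval_If_then[OF p(2) _ e] by simp
  moreover have "1 + (1 + (1 + 1 + (1 + (1 + (1 + 1) + 1) + 1 + 0 + n + 1 + 0)) + m + 1) + 1
      \<le> length (y # ys) * (T + 20) + 5"
    using n(1) m(1) by simp
  ultimately show ?case
    unfolding as_def j(2) by blast
qed

text \<open>A cheap step that doubles its accumulator would make it exponential after linearly many
  rounds. Hence the size bound \<open>b\<close> on every intermediate accumulator.\<close>

lemma ptime_foldl:
  assumes step: "ptime (\<lambda>s. step (car s) (car (cdr s)) (cdr (cdr s)))"
    and init: "ptime init" and L: "ptime (\<lambda>x. enc_list (L x))"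
    and b: "polyb b"
    and bound: "\<And>x zs ws. L x = zs @ ws \<Longrightarrow> size (foldl (step x) (init x) zs) \<le> b x"
  shows "ptime (\<lambda>x. foldl (step x) (init x) (L x))"
proof -
  from init obtain P0 e0 where "computes P0 e0 init" by (auto simp: ptime_def)
  from computes_common[OF L this] obtain P0 e0 e1 where
    fg: "computes P0 e0 init" "computes P0 e1 (\<lambda>x. enc_list (L x))" by blast
  from computes_common[OF step fg(1)] computes_extend[OF fg(2)]
  obtain P0 e0 e1 e2 where "computes P0 e0 init" "computes P0 e1 (\<lambda>x. enc_list (L x))"
    "computes P0 e2 (\<lambda>s. step (car s) (car (cdr s)) (cdr (cdr s)))" by blast
  note fg = this[THEN computes_extend[where R = "[e2, loop (length P0) (length P0 + 1)]"]]
  define i j where "i = length P0" "j = length P0 + 1"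
  define P where "P = P0 @ [e2, loop i j]"
  have ij: "i < length P" "j < length P" "P ! i = e2" "P ! j = loop i j"
    by (auto simp: P_def i_j_def nth_append)
  from fg obtain t0 t1 t2 where
      t0: "polyb t0" "\<And>x. \<exists>n\<le>t0 x. eval P [x] e0 (init x) n"
    and t1: "polyb t1" "\<And>x. \<exists>n\<le>t1 x. eval P [x] e1 (enc_list (L x)) n"
    and t2: "polyb t2" "\<And>s. \<exists>n\<le>t2 s. eval P [s] e2 (step (car s) (car (cdr s)) (cdr (cdr s))) n"
    unfolding computes_def P_def i_j_def by blast
  from t2(1) obtain k where k: "\<And>x. t2 x \<le> (size x + 2) ^ k" unfolding polyb_def by blast
  \<comment> \<open>The bound on \<open>t2\<close> at the largest packed argument of a round; the 4
    consists of the two cells of the packing and the 2 in the base.\<close>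
  define T where "T = (\<lambda>x. (size x + b x + size (enc_list (L x)) + 4) ^ k)"
  have T: "polyb T" unfolding T_def by (intro polyb_intros b ptime_size L)
  show ?thesis
  proof (rule ptimeI[of _ "\<lambda>x. t0 x + t1 x + 2 + (size (enc_list (L x)) * (T x + 20) + 5)" P
        "Call j [Param 0, e1, e0]"])
    show "polyb (\<lambda>x. size (foldl (step x) (init x) (L x)))"
      by (rule polyb_mono[OF b]) (rule bound[where ws = "[]"], simp)
    show "polyb (\<lambda>x. t0 x + t1 x + 2 + (size (enc_list (L x)) * (T x + 20) + 5))"
      by (intro polyb_intros t0 t1 T ptime_size L)
    fix x
    from t0(2)[of x] t1(2)[of x] obtain n0 n1 where
      n: "n0 \<le> t0 x" "eval P [x] e0 (init x) n0" "n1 \<le> t1 x" "eval P [x] e1 (enc_list (L x)) n1"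
      by blast
    have "\<exists>n\<le>length (L x) * (T x + 20) + 5.
      eval P [x, enc_list (L x), init x] (P ! j) (foldl (step x) (init x) (L x)) n"
    proof (rule eval_loop[OF ij(1,2,4)])
      fix zs a ws assume zs: "L x = zs @ a # ws"
      let ?s = "Cell x (Cell (foldl (step x) (init x) zs) a)"
      from t2(2)[of ?s] obtain n where n: "n \<le> t2 ?s"
        "eval P [?s] e2 (step x (foldl (step x) (init x) zs) a) n" by auto
      have "size ?s + 2 \<le> size x + b x + size (enc_list (L x)) + 4"
        using bound[OF zs] size_member[of a "L x"] zs by simp
      then have "t2 ?s \<le> T x"
        unfolding T_def by (rule order_trans[OF k power_mono]) simp
      with n ij(3) show "\<exists>n\<le>T x. eval P [?s] (P ! i) (step x (foldl (step x) (init x) zs) a) n"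
        by (meson le_trans)
    qed
    then obtain m where m: "m \<le> length (L x) * (T x + 20) + 5"
      "eval P [x, enc_list (L x), init x] (P ! j) (foldl (step x) (init x) (L x)) m" by blast
    have "eval P [x] (Param 0) x 1" using eval_Param[of P "[x]" 0] by simp
    note c = eval_Call[OF evals_Cons[OF this evals_Cons[OF n(4) evals_Cons[OF n(2) evals_Nil]]]
      ij(2) m(2)]
    have "length (L x) * (T x + 20) \<le> size (enc_list (L x)) * (T x + 20)"
      by (rule mult_right_mono) (auto intro: length_le_size)
    with m(1) n(1,3) have "1 + (n1 + (n0 + 0)) + m + 1
        \<le> t0 x + t1 x + 2 + (size (enc_list (L x)) * (T x + 20) + 5)"
      by linarith
    with c show "\<exists>n\<le>t0 x + t1 x + 2 + (size (enc_list (L x)) * (T x + 20) + 5).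
      eval P [x] (Call j [Param 0, e1, e0]) (foldl (step x) (init x) (L x)) n"
      by blast
  qed
qed

text \<open>If the growth per round does not depend on the accumulator, the total growth is at most
  linear in the number of rounds.\<close>

lemma ptime_foldl_additive:
  assumes step: "ptime (\<lambda>s. step (car s) (car (cdr s)) (cdr (cdr s)))"
    and init: "ptime init" and L: "ptime (\<lambda>x. enc_list (L x))"
    and b: "polyb b"
    and bound: "\<And>x acc a. a \<in> set (L x) \<Longrightarrow> size (step x acc a) \<le> size acc + b (Cell x a)"
  shows "ptime (\<lambda>x. foldl (step x) (init x) (L x))"
proof -
  from polyb_Cell_member[OF b ptime_size[OF L]] obtain c where
    c: "polyb c" "\<And>x a. size a \<le> size (enc_list (L x)) \<Longrightarrow> b (Cell x a) \<le> c x" by blast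
  show ?thesis
  proof (rule ptime_foldl[OF step init L])
    show "polyb (\<lambda>x. size (init x) + size (enc_list (L x)) * c x)"
      by (intro polyb_intros ptime_size init L c)
    fix x zs ws assume zs: "L x = zs @ ws"
    have "size (foldl (step x) (init x) zs) \<le> size (init x) + length zs * c x"
      using zs
    proof (induction zs arbitrary: ws rule: rev_induct)
      case (snoc a zs)
      have "size (step x (foldl (step x) (init x) zs) a) \<le>
        size (foldl (step x) (init x) zs) + b (Cell x a)"
        by (rule bound) (simp add: snoc.prems)
      also have "b (Cell x a) \<le> c x"
        by (intro c size_member) (simp add: snoc.prems)
      finally show ?case
        using snoc.IH[of "a # ws"] snoc.prems by simp
    qed simp
    also have "length zs * c x \<le> size (enc_list (L x)) * c x"
      using length_le_size[of "L x"] zs by (intro mult_right_mono) auto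
    finally show "size (foldl (step x) (init x) zs) \<le> size (init x) + size (enc_list (L x)) * c x"
      by simp
  qed
qed

definition plist :: "(sexp \<Rightarrow> sexp list) \<Rightarrow> bool" where
  "plist f \<longleftrightarrow> ptime (\<lambda>x. enc_list (f x))"

lemma plist_lst: "ptime f \<Longrightarrow> plist (\<lambda>x. lst (f x))"
  by (simp add: plist_def)

lemma ptime_enc_list: "plist f \<Longrightarrow> ptime (\<lambda>x. enc_list (f x))"
  by (simp add: plist_def)

lemma plist_Nil: "plist (\<lambda>x. [])"
  by (simp add: plist_def ptime_const)

lemma plist_Cons: "ptime f \<Longrightarrow> plist g \<Longrightarrow> plist (\<lambda>x. f x # g x)"
  by (simp add: plist_def ptime_Cell)

lemma plist_rev:
  assumes "plist L"
  shows "plist (\<lambda>x. rev (L x))"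
proof -
  have eq: "foldl (\<lambda>acc a. Cell a acc) (enc_list ys) xs = enc_list (rev xs @ ys)" for xs ys
    by (induction xs arbitrary: ys) (simp_all flip: enc_list_simps)
  have "ptime (\<lambda>x. foldl (\<lambda>acc a. Cell a acc) NIL (L x))"
    by (rule ptime_foldl_additive[OF _ _ _ polyb_size])
      (use assms in \<open>auto intro!: ptime_Cell ptime_car ptime_cdr ptime_id ptime_const
        simp: plist_def\<close>)
  then show ?thesis using eq[of "[]"] by (simp add: plist_def)
qed

text \<open>The loop consumes a list from its front, so a right fold is run as a left fold over the
  reversed list.\<close>

lemma ptime_foldr_additive:
  assumes step: "ptime (\<lambda>s. step (car s) (car (cdr s)) (cdr (cdr s)))"
    and init: "ptime init" and L: "plist L"
    and b: "polyb b"
    and bound: "\<And>x acc a. a \<in> set (L x) \<Longrightarrow> size (step x a acc) \<le> size acc + b (Cell x a)"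
  shows "ptime (\<lambda>x. foldr (step x) (L x) (init x))"
proof -
  have "ptime (\<lambda>s. Cell (car s) (Cell (cdr (cdr s)) (car (cdr s))))"
    by (intro ptime_Cell ptime_car ptime_cdr ptime_id)
  from ptime_comp[OF step this]
  have "ptime (\<lambda>s. step (car s) (cdr (cdr s)) (car (cdr s)))" by simp
  then have "ptime (\<lambda>x. foldl (\<lambda>acc a. step x a acc) (init x) (rev (L x)))"
    by (rule ptime_foldl_additive[OF _ init plist_rev[OF L, unfolded plist_def] b])
      (simp add: bound)
  then show ?thesis by (simp add: foldl_conv_foldr)
qed


lemma plist_map:
  assumes L: "plist L" and g: "ptime (\<lambda>s. g (car s) (cdr s))"
  shows "plist (\<lambda>x. map (g x) (L x))"
proof -
  have eq: "enc_list (map h xs) = foldr (\<lambda>a acc. Cell (h a) acc) xs NIL" for h xs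
    by (induction xs) auto
  have "ptime (\<lambda>s. Cell (car s) (car (cdr s)))"
    by (intro ptime_Cell ptime_car ptime_cdr ptime_id)
  from ptime_comp[OF g this]
  have "ptime (\<lambda>s. Cell (g (car s) (car (cdr s))) (cdr (cdr s)))"
    by (intro ptime_Cell) (simp_all add: ptime_cdr ptime_id)
  moreover have "polyb (\<lambda>s. size (g (car s) (cdr s)) + 1)"
    by (intro polyb_intros ptime_size[OF g])
  ultimately have "ptime (\<lambda>x. foldr (\<lambda>a acc. Cell (g x a) acc) (L x) NIL)"
    by (rule ptime_foldr_additive[OF _ ptime_const L]) auto
  then show ?thesis by (simp add: plist_def eq)
qed

lemma plist_append:
  assumes f: "plist f" and g: "plist g"
  shows "plist (\<lambda>x. f x @ g x)"
proof -
  have eq: "enc_list (xs @ ys) = foldr Cell xs (enc_list ys)" for xs ys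
    by (induction xs) auto
  have "ptime (\<lambda>x. foldr Cell (f x) (enc_list (g x)))"
    by (rule ptime_foldr_additive[where step = "\<lambda>_. Cell" and b = "\<lambda>x. size x"])
      (auto intro!: ptime_Cell ptime_car ptime_cdr ptime_id f ptime_enc_list g polyb_size)
  then show ?thesis by (simp add: plist_def eq)
qed

lemma plist_comp: "plist f \<Longrightarrow> ptime g \<Longrightarrow> plist (\<lambda>x. f (g x))"
  unfolding plist_def by (rule ptime_comp)

lemma plist_concat_map:
  assumes L: "plist L" and g: "plist (\<lambda>s. g (car s) (cdr s))"
  shows "plist (\<lambda>x. concat (map (g x) (L x)))"
proof -
  have eq: "enc_list (concat (map h xs)) = foldr (\<lambda>a acc. enc_list (h a @ lst acc)) xs NIL" for h xs
    by (induction xs) (simp_all, metis lst_enc_list)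
  have "ptime (\<lambda>s. Cell (car s) (car (cdr s)))"
    by (intro ptime_Cell ptime_car ptime_cdr ptime_id)
  from plist_comp[OF g this]
  have "ptime (\<lambda>s. enc_list (g (car s) (car (cdr s)) @ lst (cdr (cdr s))))"
    by (intro ptime_enc_list plist_append plist_lst ptime_cdr ptime_id) simp
  moreover have "polyb (\<lambda>s. size (enc_list (g (car s) (cdr s))))"
    by (intro ptime_size ptime_enc_list g)
  ultimately have "ptime (\<lambda>x. foldr (\<lambda>a acc. enc_list (g x a @ lst acc)) (L x) NIL)"
    by (rule ptime_foldr_additive[OF _ ptime_const L])
      simp
  then show ?thesis by (simp add: plist_def eq)
qed

section \<open>Boolean connectives, filters and bounded quantifiers\<close>

lemma pbool_not:
  assumes "pbool P"
  shows "pbool (\<lambda>x. \<not> P x)"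
proof -
  have "(\<lambda>x. if P x then False else True) = (\<lambda>x. \<not> P x)" by auto
  with pbool_If[OF assms pbool_const[of False] pbool_const[of True]] show ?thesis by simp
qed

lemma pbool_conj:
  assumes "pbool P" "pbool Q"
  shows "pbool (\<lambda>x. P x \<and> Q x)"
proof -
  have "(\<lambda>x. if P x then Q x else False) = (\<lambda>x. P x \<and> Q x)" by auto
  with pbool_If[OF assms pbool_const[of False]] show ?thesis by simp
qed

lemma pbool_disj: "pbool P \<Longrightarrow> pbool Q \<Longrightarrow> pbool (\<lambda>x. P x \<or> Q x)"
  using pbool_not[OF pbool_conj[OF pbool_not pbool_not]] by simp

lemma pbool_imp: "pbool P \<Longrightarrow> pbool Q \<Longrightarrow> pbool (\<lambda>x. P x \<longrightarrow> Q x)"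
  unfolding imp_conv_disj by (intro pbool_disj pbool_not)

lemma pbool_NIL:
  assumes "ptime f"
  shows "pbool (\<lambda>x. f x = NIL)"
proof -
  have "(\<lambda>x. if f x \<noteq> NIL then NIL else tt) = (\<lambda>x. if f x = NIL then tt else NIL)" by auto
  with ptime_If_NIL[OF ptime_const[of NIL] ptime_const[of tt] assms] show ?thesis
    by (simp add: pbool_def)
qed

lemma plist_filter:
  assumes L: "plist L" and P: "pbool (\<lambda>s. P (car s) (cdr s))"
  shows "plist (\<lambda>x. filter (P x) (L x))"
proof -
  have eq: "enc_list (filter Q xs) = foldr (\<lambda>a acc. if Q a then Cell a acc else acc) xs NIL" for Q xs
    by (induction xs) auto
  have "ptime (\<lambda>s. Cell (car s) (car (cdr s)))"
    by (intro ptime_Cell ptime_car ptime_cdr ptime_id)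
  from pbool_comp[OF P this]
  have "ptime (\<lambda>s. if P (car s) (car (cdr s)) then Cell (car (cdr s)) (cdr (cdr s)) else cdr (cdr s))"
    by (intro ptime_If ptime_Cell ptime_car ptime_cdr ptime_id) simp
  then have "ptime (\<lambda>x. foldr (\<lambda>a acc. if P x a then Cell a acc else acc) (L x) NIL)"
    by (rule ptime_foldr_additive[OF _ ptime_const L polyb_size]) simp
  then show ?thesis by (simp add: plist_def eq)
qed

lemma pbool_ball:
  assumes L: "plist L" and P: "pbool (\<lambda>s. P (car s) (cdr s))"
  shows "pbool (\<lambda>x. \<forall>a\<in>set (L x). P x a)"
proof -
  have "pbool (\<lambda>x. enc_list (filter (\<lambda>a. \<not> P x a) (L x)) = NIL)"
    by (intro pbool_NIL ptime_enc_list plist_filter L pbool_not P)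
  moreover have "enc_list xs = NIL \<longleftrightarrow> xs = []" for xs by (cases xs) auto
  ultimately show ?thesis by (simp add: filter_empty_conv)
qed

lemma pbool_bex:
  assumes L: "plist L" and P: "pbool (\<lambda>s. P (car s) (cdr s))"
  shows "pbool (\<lambda>x. \<exists>a\<in>set (L x). P x a)"
  using pbool_not[OF pbool_ball[OF L pbool_not[OF P]]] by simp

section \<open>Structural equality of trees\<close>

definition eq_body :: expr where
  "eq_body = If_expr (Param 0)
     (If_expr (Param 1)
       (If_expr (Call 0 [Car (Param 0), Car (Param 1)])
         (Call 0 [Cdr (Param 0), Cdr (Param 1)]) Nil_expr)
       Nil_expr)
     (If_expr (Param 1) Nil_expr (Cons_expr Nil_expr Nil_expr))"

text \<open>The recursion visits each cell of \<open>a\<close> at most once. A cell leads to two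
  recursive calls with offset 10 each; the slope 30 pays for these and for the overhead.\<close>

lemma eval_eq_body:
  "\<exists>n\<le>30 * size a + 10. eval [eq_body] [a, b] eq_body (if a = b then tt else NIL) n"
proof (induction a arbitrary: b)
  case NIL
  have p: "eval [eq_body] [NIL, b] (Param 0) NIL 1" "eval [eq_body] [NIL, b] (Param 1) b 1"
    using eval_Param[of "[eq_body]" "[NIL, b]" 0] eval_Param[of "[eq_body]" "[NIL, b]" 1] by auto
  show ?case
  proof (cases b)
    case NIL
    have "eval [eq_body] [NIL, b] eq_body tt (1 + (1 + (1 + 1 + 1) + 1) + 1)"
      unfolding tt_def by (subst (2) eq_body_def)
        (intro eval_If_else eval_Cons eval_Nil p p(2)[unfolded NIL], use p NIL in simp_all)
    then show ?thesis using NIL by (intro exI[of _ "1 + (1 + (1 + 1 + 1) + 1) + 1"]) simp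
  next
    case (Cell b1 b2)
    have "eval [eq_body] [NIL, b] eq_body NIL (1 + (1 + 1 + 1) + 1)"
      by (subst (2) eq_body_def)
        (rule eval_If_else[OF p(1) eval_If_then[OF p(2) _ eval_Nil]], use Cell in simp)
    then show ?thesis using Cell by (intro exI[of _ "1 + (1 + 1 + 1) + 1"]) simp
  qed
next
  case (Cell a1 a2)
  let ?as = "[Cell a1 a2, b]"
  have p: "eval [eq_body] ?as (Param 0) (Cell a1 a2) 1" "eval [eq_body] ?as (Param 1) b 1"
    using eval_Param[of "[eq_body]" ?as 0] eval_Param[of "[eq_body]" ?as 1] by auto
  show ?case
  proof (cases b)
    case NIL
    have "eval [eq_body] ?as (Param 1) NIL 1" using p(2) NIL by simp
    then have "eval [eq_body] ?as eq_body NIL (1 + (1 + 1 + 1) + 1)"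
      by (subst (2) eq_body_def) (rule eval_If_then[OF p(1) _ eval_If_else[OF _ eval_Nil]], simp)
    then show ?thesis using NIL by (intro exI[of _ "1 + (1 + 1 + 1) + 1"]) simp
  next
    case b: (Cell b1 b2)
    from Cell.IH(1)[of b1] obtain n1 where n1: "n1 \<le> 30 * size a1 + 10"
      "eval [eq_body] [a1, b1] eq_body (if a1 = b1 then tt else NIL) n1" by blast
    from Cell.IH(2)[of b2] obtain n2 where n2: "n2 \<le> 30 * size a2 + 10"
      "eval [eq_body] [a2, b2] eq_body (if a2 = b2 then tt else NIL) n2" by blast
    have c: "eval [eq_body] ?as (Car (Param 0)) a1 (1 + 1)" "eval [eq_body] ?as (Car (Param 1)) b1 (1 + 1)"
      "eval [eq_body] ?as (Cdr (Param 0)) a2 (1 + 1)" "eval [eq_body] ?as (Cdr (Param 1)) b2 (1 + 1)"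
      using p[THEN eval_Car] p[THEN eval_Cdr] b by auto
    have c1: "eval [eq_body] ?as (Call 0 [Car (Param 0), Car (Param 1)])
        (if a1 = b1 then tt else NIL) (1 + 1 + (1 + 1 + 0) + n1 + 1)"
      by (rule eval_Call[OF evals_Cons[OF c(1) evals_Cons[OF c(2) evals_Nil]]]) (use n1 in simp_all)
    have c2: "eval [eq_body] ?as (Call 0 [Cdr (Param 0), Cdr (Param 1)])
        (if a2 = b2 then tt else NIL) (1 + 1 + (1 + 1 + 0) + n2 + 1)"
      by (rule eval_Call[OF evals_Cons[OF c(3) evals_Cons[OF c(4) evals_Nil]]]) (use n2 in simp_all)
    have "\<exists>n\<le>n1 + n2 + 11. eval [eq_body] ?as (If_expr (Call 0 [Car (Param 0), Car (Param 1)])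
         (Call 0 [Cdr (Param 0), Cdr (Param 1)]) Nil_expr)
        (if Cell a1 a2 = b then tt else NIL) n"
    proof (cases "a1 = b1")
      case True
      with eval_If_then[OF c1 _ c2, of Nil_expr] b show ?thesis
        by (intro exI[of _ "1 + 1 + (1 + 1 + 0) + n1 + 1 + (1 + 1 + (1 + 1 + 0) + n2 + 1) + 1"]) simp
    next
      case False
      with c1 have "eval [eq_body] ?as (Call 0 [Car (Param 0), Car (Param 1)])
        NIL (1 + 1 + (1 + 1 + 0) + n1 + 1)" by simp
      from eval_If_else[OF this eval_Nil] False b show ?thesis
        by (intro exI[of _ "1 + 1 + (1 + 1 + 0) + n1 + 1 + 1 + 1"]) simp
    qed
    then obtain n where n: "n \<le> n1 + n2 + 11"
      "eval [eq_body] ?as (If_expr (Call 0 [Car (Param 0), Car (Param 1)])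
         (Call 0 [Cdr (Param 0), Cdr (Param 1)]) Nil_expr)
        (if Cell a1 a2 = b then tt else NIL) n" by blast
    have "eval [eq_body] ?as eq_body (if Cell a1 a2 = b then tt else NIL) (1 + (1 + n + 1) + 1)"
      by (subst (2) eq_body_def)
        (rule eval_If_then[OF p(1) _ eval_If_then[OF p(2) _ n(2)]], use b in simp_all)
    moreover have "1 + (1 + n + 1) + 1 \<le> 30 * size (Cell a1 a2) + 10"
      using n(1) n1(1) n2(1) by simp
    ultimately show ?thesis by blast
  qed
qed

lemma pbool_eq:
  assumes "ptime f" "ptime g"
  shows "pbool (\<lambda>x. f x = g x)"
proof -
  have "pbool (\<lambda>s. car s = cdr s)"
    unfolding pbool_def
  proof (rule ptimeI[of _ "\<lambda>x. 30 * size x + 15" "[eq_body]" "Call 0 [Car (Param 0), Cdr (Param 0)]"])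
    show "polyb (\<lambda>x. size (if car x = cdr x then tt else NIL))"
      by (rule polyb_mono[OF polyb_const[of "size tt"]]) auto
    show "polyb (\<lambda>x. 30 * size x + 15)" by (intro polyb_intros)
    fix x
    have p: "eval [eq_body] [x] (Param 0) x 1" using eval_Param[of "[eq_body]" "[x]" 0] by simp
    from eval_eq_body[of "car x" "cdr x"] obtain n where
      n: "n \<le> 30 * size (car x) + 10"
      "eval [eq_body] [car x, cdr x] eq_body (if car x = cdr x then tt else NIL) n" by blast
    have "eval [eq_body] [x] (Call 0 [Car (Param 0), Cdr (Param 0)])
      (if car x = cdr x then tt else NIL) (1 + 1 + (1 + 1 + 0) + n + 1)"
      by (rule eval_Call[OF evals_Cons[OF eval_Car[OF p] evals_Cons[OF eval_Cdr[OF p] evals_Nil]]])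
        (use n in simp_all)
    moreover have "size (car x) \<le> size x" by (cases x) auto
    with n have "1 + 1 + (1 + 1 + 0) + n + 1 \<le> 30 * size x + 15" by simp
    ultimately show "\<exists>n\<le>30 * size x + 15. eval [eq_body] [x] (Call 0 [Car (Param 0), Cdr (Param 0)])
      (if car x = cdr x then tt else NIL) n" by blast
  qed
  from pbool_comp[OF this ptime_Cell[OF assms]] show ?thesis by simp
qed


subsection \<open>Unary numbers\<close>

definition un :: "nat \<Rightarrow> sexp" where "un n = enc_list (replicate n NIL)"

lemma un_simps [simp]: "un 0 = NIL" "un (Suc n) = Cell NIL (un n)"
  by (simp_all add: un_def)

lemma length_lst_un [simp]: "length (lst (un n)) = n"
  by (simp add: un_def)

lemma size_un [simp]: "size (un n) = n"
  by (induction n) auto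

lemma un_eq_NIL [simp]: "un n = NIL \<longleftrightarrow> n = 0"
  by (cases n) auto

text \<open>Unary values serve as counters and positions: arithmetic becomes list manipulation, and
  by \<open>size (un n) = n\<close> the number \<open>f x\<close> itself is polynomially
  bounded.\<close>

definition pnat :: "(sexp \<Rightarrow> nat) \<Rightarrow> bool" where
  "pnat f \<longleftrightarrow> ptime (\<lambda>x. un (f x))"

lemma pnat_comp: "pnat f \<Longrightarrow> ptime g \<Longrightarrow> pnat (\<lambda>x. f (g x))"
  unfolding pnat_def by (rule ptime_comp)

lemma ptime_un: "pnat f \<Longrightarrow> ptime (\<lambda>x. un (f x))"
  by (simp add: pnat_def)

lemma pnat_length: "plist L \<Longrightarrow> pnat (\<lambda>x. length (L x))"
  using plist_map[of L "\<lambda>_ _. NIL"]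
  by (simp add: pnat_def un_def plist_def ptime_const map_replicate_const)

lemma pnat_const: "pnat (\<lambda>_. n)"
  by (simp add: pnat_def ptime_const)

lemma plist_replicate_NIL: "pnat n \<Longrightarrow> plist (\<lambda>x. replicate (n x) NIL)"
  by (simp add: pnat_def un_def plist_def)

lemma pnat_add: "pnat f \<Longrightarrow> pnat g \<Longrightarrow> pnat (\<lambda>x. f x + g x)"
  using pnat_length[OF plist_append[OF plist_replicate_NIL plist_replicate_NIL]] by simp

lemma plist_drop:
  assumes n: "pnat n" and L: "plist L"
  shows "plist (\<lambda>x. drop (n x) (L x))"
proof -
  have eq: "foldl (\<lambda>acc _. cdr acc) (enc_list xs) (replicate m NIL) = enc_list (drop m xs)" for m xs
  proof (induction m arbitrary: xs)
    case (Suc m)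
    then show ?case using Suc[of "[]"] by (cases xs) simp_all
  qed simp
  have *: "size (cdr x) \<le> size x" for x by (cases x) auto
  have "ptime (\<lambda>x. foldl (\<lambda>acc _. cdr acc) (enc_list (L x)) (replicate (n x) NIL))"
    by (rule ptime_foldl_additive[OF _ _ _ polyb_size])
      (auto intro!: ptime_cdr ptime_car ptime_id ptime_enc_list plist_replicate_NIL n L
        order_trans[OF *])
  then show ?thesis by (simp add: eq plist_def)
qed

lemma pnat_diff: "pnat f \<Longrightarrow> pnat g \<Longrightarrow> pnat (\<lambda>x. f x - g x)"
  using pnat_length[OF plist_drop[OF _ plist_replicate_NIL]] by simp

lemma pnat_mult: 
  assumes f: "pnat f" and g: "pnat g" 
  shows "pnat (\<lambda>x. f x * g x)"
proof -
  have "plist (\<lambda>x. concat (map (\<lambda>_. replicate (g x) NIL) (replicate (f x) NIL)))"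
    by (intro plist_concat_map plist_replicate_NIL f)
      (rule pnat_comp[OF g ptime_car_id])
  from pnat_length[OF this] show ?thesis
    by (simp add: length_concat sum_list_replicate)
qed

lemma pbool_nat_le: "pnat f \<Longrightarrow> pnat g \<Longrightarrow> pbool (\<lambda>x. f x \<le> g x)"
  using pbool_NIL[OF ptime_un[OF pnat_diff, of f g]] by simp

lemma pbool_nat_less: "pnat f \<Longrightarrow> pnat g \<Longrightarrow> pbool (\<lambda>x. f x < g x)"
  using pbool_not[OF pbool_nat_le, of g f] by (simp add: not_le)

lemma pbool_nat_eq: "pnat f \<Longrightarrow> pnat g \<Longrightarrow> pbool (\<lambda>x. f x = g x)"
  using pbool_conj[OF pbool_nat_le pbool_nat_le, of f g g f] by (simp add: eq_iff)

text \<open>The default \<open>NIL\<close> is what \<open>car\<close> and \<open>cdr\<close> yield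
  past the end of a list, so the lookup compiles without a range check.\<close>

definition nthd :: "sexp list \<Rightarrow> nat \<Rightarrow> sexp" where
  "nthd xs i = (if i < length xs then xs ! i else NIL)"

lemma nthd_nth [simp]: "i < length xs \<Longrightarrow> nthd xs i = xs ! i"
  by (simp add: nthd_def)

lemma ptime_nthd:
  assumes L: "plist L" and i: "pnat i"
  shows "ptime (\<lambda>x. nthd (L x) (i x))"
proof -
  have "nthd xs i = car (enc_list (drop i xs))" for xs i
    by (cases "drop i xs") (auto simp: nthd_def drop_eq_Nil Cons_nth_drop_Suc
        dest: nth_via_drop split: if_splits)
  with ptime_car[OF ptime_enc_list[OF plist_drop[OF i L]]] show ?thesis by simp
qed

lemma plist_upt:
  assumes n: "pnat n"
  shows "plist (\<lambda>x. map un [0..<n x])"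
proof -
  \<comment> \<open>The accumulator is its own counter: its length is the next number to be put in
    front.\<close>
  let ?step = "\<lambda>acc _. Cell (un (length (lst acc))) acc"
  have eq: "foldl ?step NIL zs = enc_list (rev (map un [0..<length zs]))" for zs :: "sexp list"
    by (induction zs rule: rev_induct) auto
  have s: "size (enc_list (rev (map un [0..<k]))) \<le> k * k" for k
    by (induction k) auto
  have "ptime (\<lambda>x. foldl ?step NIL (replicate (n x) NIL))"
  proof (rule ptime_foldl[where b = "\<lambda>x. size (un (n x)) * size (un (n x))"])
    show "polyb (\<lambda>x. size (un (n x)) * size (un (n x)))"
      by (intro polyb_intros ptime_size ptime_un n)
    fix x zs ws assume "replicate (n x) NIL = zs @ ws"
    then have "length zs \<le> n x" by (metis length_append length_replicate le_add1)
    then show "size (foldl ?step NIL zs) \<le> size (un (n x)) * size (un (n x))"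
      unfolding eq using s[of "length zs"] by (auto intro: order_trans mult_le_mono)
  qed (intro ptime_Cell ptime_car ptime_cdr ptime_id ptime_const ptime_un pnat_length plist_lst
      ptime_enc_list plist_replicate_NIL n)+
  then show ?thesis using plist_rev[of "\<lambda>x. rev (map un [0..<n x])"]
    by (simp add: eq plist_def)
qed

text \<open>Loop elements are trees, so an index reaches the predicate in unary and is decoded by
  \<open>length (lst _)\<close>; the hypotheses of the following rules have the same form.\<close>

lemma plist_filter_upt:
  assumes n: "pnat n" and P: "pbool (\<lambda>s. P (car s) (length (lst (cdr s))))"
  shows "plist (\<lambda>x. map un (filter (P x) [0..<n x]))"
proof -
  have "plist (\<lambda>x. filter (\<lambda>u. P x (length (lst u))) (map un [0..<n x]))"
    by (intro plist_filter plist_upt n P)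
  then show ?thesis by (simp add: filter_map comp_def)
qed

lemma plist_map_upt:
  assumes n: "pnat n" and f: "ptime (\<lambda>s. f (car s) (length (lst (cdr s))))"
  shows "plist (\<lambda>x. map (f x) [0..<n x])"
proof -
  have "plist (\<lambda>x. map (\<lambda>u. f x (length (lst u))) (map un [0..<n x]))"
    by (intro plist_map plist_upt n f)
  then show ?thesis by (simp add: comp_def)
qed

lemma plist_concat_map_upt:
  assumes n: "pnat n" and f: "plist (\<lambda>s. f (car s) (length (lst (cdr s))))"
  shows "plist (\<lambda>x. concat (map (f x) [0..<n x]))"
proof -
  have "plist (\<lambda>x. concat (map (\<lambda>u. f x (length (lst u))) (map un [0..<n x])))"
    by (intro plist_concat_map plist_upt n f)
  then show ?thesis by (simp add: comp_def)
qed

lemma pbool_all_less: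
  assumes n: "pnat n" and P: "pbool (\<lambda>s. P (car s) (length (lst (cdr s))))"
  shows "pbool (\<lambda>x. \<forall>i<n x. P x i)"
proof -
  have "pbool (\<lambda>x. \<forall>u\<in>set (map un [0..<n x]). P x (length (lst u)))"
    by (intro pbool_ball plist_upt n P)
  moreover have "(\<forall>u\<in>set (map un [0..<k]). Q (length (lst u))) \<longleftrightarrow> (\<forall>i<k. Q i)" for k Q
    by auto
  ultimately show ?thesis by simp
qed

lemma pbool_ex_less:
  assumes n: "pnat n" and P: "pbool (\<lambda>s. P (car s) (length (lst (cdr s))))"
  shows "pbool (\<lambda>x. \<exists>i<n x. P x i)"
  using pbool_not[OF pbool_all_less[OF n pbool_not[OF P]]] by simp

subsection \<open>Binary numbers\<close>

fun bvl :: "sexp list \<Rightarrow> nat" where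
  "bvl [] = 0"
| "bvl (a # as) = of_bool (a \<noteq> NIL) + 2 * bvl as"

lemma bvl_append: "bvl (xs @ ys) = bvl xs + 2 ^ length xs * bvl ys"
  by (induction xs) (auto simp: algebra_simps)

abbreviation bval :: "sexp \<Rightarrow> nat" where "bval x \<equiv> bvl (lst x)"

lemma bval_enc_nat [simp]: "bval (enc_nat n) = n"
proof (induction n rule: less_induct)
  case (less n)
  then show ?case
    by (subst enc_nat.simps) auto
qed

lemma enc_nat_inject [simp]: "enc_nat m = enc_nat n \<longleftrightarrow> m = n"
  by (metis bval_enc_nat)

definition of_bit :: "bool \<Rightarrow> sexp" where "of_bit b = (if b then tt else NIL)"

lemma of_bit_eq_NIL [simp]: "of_bit b = NIL \<longleftrightarrow> \<not> b"
  by (auto simp: of_bit_def)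

lemma pbool_iff:
  assumes "pbool P" "pbool Q"
  shows "pbool (\<lambda>x. P x \<longleftrightarrow> Q x)"
  unfolding iff_conv_conj_imp by (intro pbool_conj pbool_imp assms)

lemma size_of_bit [simp]: "size (of_bit b) = of_bool b"
  by (simp add: of_bit_def tt_def)

lemma ptime_of_bit: "pbool P \<Longrightarrow> ptime (\<lambda>x. of_bit (P x))"
  by (simp add: of_bit_def pbool_def)

text \<open>The state is \<open>Cell x (Cell y (Cell c r))\<close>: the remaining digits of the summands,
  the carry, and the digits of the sum found so far, most significant first.\<close>

definition add_step :: "sexp \<Rightarrow> sexp" where
  "add_step s = (let a = car (car s) \<noteq> NIL; b = car (car (cdr s)) \<noteq> NIL; c = car (cdr (cdr s)) \<noteq> NIL in
     Cell (cdr (car s)) (Cell (cdr (car (cdr s)))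
       (Cell (of_bit (a \<and> b \<or> a \<and> c \<or> b \<and> c))
         (Cell (of_bit (a \<longleftrightarrow> (b \<longleftrightarrow> c))) (cdr (cdr (cdr s)))))))"

text \<open>The carry stands directly in front of the result digits, so after the reversal it is
  their most significant digit.\<close>

definition add_res :: "sexp \<Rightarrow> sexp list" where
  "add_res s = rev (lst (cdr (cdr s)))"

text \<open>The folded list is a clock that runs for the length of the longer summand; its entries
  are ignored. By \<open>cdr NIL = NIL\<close> the shorter summand is padded with zeros.\<close>

definition badd :: "sexp \<Rightarrow> sexp \<Rightarrow> sexp list" where
  "badd x y = add_res (foldl (\<lambda>s _. add_step s) (Cell x (Cell y (Cell NIL NIL)))
     (lst x @ drop (length (lst x)) (lst y)))"

text \<open>Digits may be arbitrary trees in general; for canonical ones the length of a number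
  controls its size.\<close>

definition digits :: "sexp list \<Rightarrow> bool" where
  "digits xs \<longleftrightarrow> set xs \<subseteq> {NIL, tt}"

lemma digits_Nil: "digits []"
  by (simp add: digits_def)

lemma size_digits: "digits xs \<Longrightarrow> size (enc_list xs) \<le> 2 * length xs"
  by (induction xs) (auto simp: digits_def tt_def)

lemma cdr_drop: "cdr (enc_list xs) = enc_list (drop 1 xs)"
  by (cases xs) auto

lemma car_nthd: "car (enc_list xs) = nthd xs 0"
  by (cases xs) (auto simp: nthd_def)

lemma bvl_split: "bvl xs = of_bool (nthd xs 0 \<noteq> NIL) + 2 * bvl (drop 1 xs)"
  by (cases xs) (auto simp: nthd_def)

text \<open>The invariant of schoolbook addition: each round moves value from the shifted remainder
  and carry into the digits already found, and the total stays fixed.\<close>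

lemma add_loop:
  fixes xs ys zs :: "sexp list"
  defines "s \<equiv> foldl (\<lambda>s _. add_step s) (Cell (enc_list xs) (Cell (enc_list ys) (Cell NIL NIL))) zs"
  shows "\<exists>c rs. s = Cell (enc_list (drop (length zs) xs)) (Cell (enc_list (drop (length zs) ys))
      (Cell (of_bit c) (enc_list rs))) \<and> digits rs \<and> length rs = length zs \<and>
    bvl (rev rs) + 2 ^ length zs * (of_bool c + bvl (drop (length zs) xs) + bvl (drop (length zs) ys))
      = bvl xs + bvl ys"
  unfolding s_def
proof (induction zs rule: rev_induct)
  case Nil
  show ?case by (intro exI[of _ False] exI[of _ "[]"]) (simp add: of_bit_def digits_def)
next
  case (snoc z zs)
  define xs' ys' where "xs' = drop (length zs) xs" "ys' = drop (length zs) ys"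
  from snoc obtain c rs where *: "foldl (\<lambda>s _. add_step s)
      (Cell (enc_list xs) (Cell (enc_list ys) (Cell NIL NIL))) zs =
      Cell (enc_list xs') (Cell (enc_list ys') (Cell (of_bit c) (enc_list rs)))"
    "digits rs" "length rs = length zs"
    "bvl (rev rs) + 2 ^ length zs * (of_bool c + bvl xs' + bvl ys') = bvl xs + bvl ys"
    unfolding xs'_ys'_def by blast
  define a b where "a = (nthd xs' 0 \<noteq> NIL)" "b = (nthd ys' 0 \<noteq> NIL)"
  \<comment> \<open>A full adder: \<open>c'\<close> is the majority of the three bits and
    \<open>r\<close> their parity.\<close>
  define c' r where "c' = (a \<and> b \<or> a \<and> c \<or> b \<and> c)" "r = (a \<longleftrightarrow> (b \<longleftrightarrow> c))"
  have d: "drop (length (zs @ [z])) xs = drop 1 xs'" "drop (length (zs @ [z])) ys = drop 1 ys'"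
    by (auto simp: xs'_ys'_def)
  have "add_step (Cell (enc_list xs') (Cell (enc_list ys') (Cell (of_bit c) (enc_list rs))))
    = Cell (enc_list (drop 1 xs')) (Cell (enc_list (drop 1 ys'))
        (Cell (of_bit c') (enc_list (of_bit r # rs))))"
    by (simp add: add_step_def Let_def cdr_drop car_nthd c'_r_def a_b_def)
  then have "foldl (\<lambda>s _. add_step s) (Cell (enc_list xs) (Cell (enc_list ys) (Cell NIL NIL))) (zs @ [z])
    = Cell (enc_list (drop 1 xs')) (Cell (enc_list (drop 1 ys'))
        (Cell (of_bit c') (enc_list (of_bit r # rs))))"
    by (simp only: foldl_append foldl.simps *(1))
  moreover have "bvl (rev (of_bit r # rs)) +
    2 ^ length (zs @ [z]) * (of_bool c' + bvl (drop 1 xs') + bvl (drop 1 ys')) = bvl xs + bvl ys"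
  proof -
    have "of_bool r + 2 * of_bool c' = (of_bool a + of_bool b + of_bool c :: nat)"
      by (auto simp: c'_r_def)
    then have eq: "of_bool r + 2 * (of_bool c' + bvl (drop 1 xs') + bvl (drop 1 ys'))
      = of_bool c + bvl xs' + bvl ys'"
      unfolding bvl_split[of xs'] bvl_split[of ys'] a_b_def by simp
    have "bvl (rev (of_bit r # rs)) +
      2 ^ length (zs @ [z]) * (of_bool c' + bvl (drop 1 xs') + bvl (drop 1 ys')) =
      bvl (rev rs) + 2 ^ length zs *
        (of_bool r + 2 * (of_bool c' + bvl (drop 1 xs') + bvl (drop 1 ys')))"
      unfolding rev.simps bvl_append length_rev *(3) distrib_left[of "2 ^ length zs"] by simp
    then show ?thesis unfolding eq *(4) .
  qed
  moreover have "digits (of_bit r # rs)"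
    using *(2) by (auto simp: digits_def of_bit_def)
  ultimately show ?case unfolding d
    by (intro exI[of _ c'] exI[of _ "of_bit r # rs"]) (simp add: *(3))
qed

lemma badd:
  shows bvl_badd: "bvl (badd x y) = bval x + bval y"
    and digits_badd: "digits (badd x y)"
    and length_badd: "length (badd x y) = max (length (lst x)) (length (lst y)) + 1"
proof -
  define zs where "zs = lst x @ drop (length (lst x)) (lst y)"
  have len: "length zs = max (length (lst x)) (length (lst y))" by (simp add: zs_def)
  from add_loop[of "lst x" "lst y" zs] obtain c rs where *:
    "foldl (\<lambda>s _. add_step s) (Cell x (Cell y (Cell NIL NIL))) zs =
      Cell NIL (Cell NIL (Cell (of_bit c) (enc_list rs)))"
    "digits rs" "length rs = length zs" "bvl (rev rs) + 2 ^ length zs * of_bool c = bval x + bval y"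
    by (auto simp: len)
  have "badd x y = rev (of_bit c # rs)"
    by (simp add: badd_def add_res_def flip: zs_def) (simp add: *(1))
  then show "bvl (badd x y) = bval x + bval y" "digits (badd x y)"
    "length (badd x y) = max (length (lst x)) (length (lst y)) + 1"
    using * len by (auto simp: bvl_append digits_def of_bit_def)
qed

lemmas basic_intros = ptime_Cell ptime_car ptime_cdr ptime_id ptime_const

lemma plist_badd:
  assumes "ptime f" "ptime g"
  shows "plist (\<lambda>x. badd (f x) (g x))"
proof -
  have [simp]: "size (car x) \<le> size x" "size (cdr x) \<le> size x" for x by (cases x; simp)+
  have "size (add_step s) \<le> size s + 10" for s
  proof -
    have "size (cdr (car s)) + size (cdr (car (cdr s))) + size (cdr (cdr (cdr s))) \<le> size s"
      by (cases s; cases "car s"; cases "cdr s"; cases "car (cdr s)"; cases "cdr (cdr s)"; simp)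
    then show ?thesis
      unfolding add_step_def Let_def sexp.size by simp
  qed
  then have step: "size (add_step s) \<le> size s + 10" for s by blast
  have "ptime add_step" unfolding add_step_def Let_def
    by (intro basic_intros ptime_of_bit pbool_conj pbool_disj pbool_not pbool_NIL pbool_iff)
  note add_step = ptime_comp[OF this]
  have "ptime (\<lambda>x. foldl (\<lambda>s _. add_step s)
      (Cell (f x) (Cell (g x) (Cell NIL NIL)))
      (lst (f x) @ drop (length (lst (f x))) (lst (g x))))"
    by (intro ptime_foldl_additive[OF _ _ _ polyb_const step] add_step basic_intros assms ptime_enc_list
      plist_append plist_drop plist_lst pnat_length)
  then show ?thesis
    unfolding badd_def add_res_def by (intro plist_rev plist_lst ptime_cdr)
qed

text \<open>Horner's scheme: \<open>Cell NIL acc\<close> doubles the partial product.\<close>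

definition bmul :: "sexp list \<Rightarrow> sexp \<Rightarrow> sexp" where
  "bmul xs y = foldr (\<lambda>a acc. enc_list (badd (if a = NIL then NIL else y) (Cell NIL acc))) xs NIL"

lemma bval_bmul: "bval (bmul xs y) = bvl xs * bval y"
  unfolding bmul_def by (induction xs) (auto simp: bvl_badd algebra_simps)

text \<open>Beyond the length of \<open>y\<close>, a round costs at most two digits, one for the
  doubling and one for the carry.\<close>

lemma bmul_bound: "digits (lst (bmul xs y)) \<and> length (lst (bmul xs y)) \<le> length (lst y) + 2 * length xs"
  unfolding bmul_def by (induction xs) (auto simp: digits_badd length_badd, simp add: digits_def)

lemma size_bmul: "size (bmul xs y) \<le> 2 * (size y + 2 * length xs)"
proof -
  have "size (bmul xs y) \<le> 2 * length (lst (bmul xs y))"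
    using size_digits[OF conjunct1[OF bmul_bound]] by simp
  also have "\<dots> \<le> 2 * (length (lst y) + 2 * length xs)"
    using bmul_bound[of xs y] by simp
  also have "\<dots> \<le> 2 * (size y + 2 * length xs)"
    using length_lst[of y] by simp
  finally show ?thesis .
qed

lemma ptime_bmul:
  assumes f: "plist f" and g: "ptime g"
  shows "ptime (\<lambda>x. bmul (f x) (g x))"
proof -
  have bm: "bmul xs y = foldl (\<lambda>acc a. enc_list (badd (if a = NIL then NIL else y) (Cell NIL acc))) NIL (rev xs)"
    for xs y by (simp add: bmul_def foldl_conv_foldr)
  show ?thesis unfolding bm
  proof (rule ptime_foldl)
    show "polyb (\<lambda>x. 2 * (size (g x) + 2 * size (enc_list (f x))))"
      by (intro polyb_intros ptime_size g ptime_enc_list f)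
    fix x zs ws assume "rev (f x) = zs @ ws"
    then have "length zs \<le> size (enc_list (f x))"
      by (metis le_add1 le_trans length_append length_le_size length_rev)
    then show "size (foldl (\<lambda>acc a. enc_list (badd (if a = NIL then NIL else g x) (Cell NIL acc))) NIL zs)
      \<le> 2 * (size (g x) + 2 * size (enc_list (f x)))"
      using size_bmul[of "rev zs" "g x"] by (simp add: bm)
  qed (intro basic_intros ptime_enc_list plist_badd ptime_If pbool_NIL plist_rev f ptime_comp[OF g])+
qed

text \<open>Digits arrive least significant first, so a difference overrides the verdict reached so
  far, and equal digits keep it.\<close>

definition ble_step :: "sexp \<Rightarrow> sexp \<Rightarrow> sexp" where
  "ble_step s a = (let b = car (car s) in
     Cell (cdr (car s)) (if (a = NIL) = (b = NIL) then cdr s else of_bit (b \<noteq> NIL)))"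

lemma ble_loop:
  "length ys \<le> length xs \<Longrightarrow>
    cdr (foldl ble_step (Cell (enc_list ys) (of_bit r)) xs) = of_bit (bvl xs < bvl ys \<or> bvl xs = bvl ys \<and> r)"
proof (induction xs arbitrary: ys r)
  case (Cons a xs)
  have "ble_step (Cell (enc_list ys) (of_bit r)) a = Cell (enc_list (drop 1 ys))
    (of_bit (if (a = NIL) = (nthd ys 0 = NIL) then r else nthd ys 0 \<noteq> NIL))"
    by (simp add: ble_step_def Let_def cdr_drop car_nthd)
  moreover have "of_bool p + 2 * m < of_bool q + 2 * n \<or> of_bool p + 2 * m = of_bool q + 2 * n \<and> r
    \<longleftrightarrow> m < n \<or> m = n \<and> (if p = q then r else q)" for m n :: nat and p q
    by (cases p; cases q; cases r; simp; presburger?)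
  ultimately show ?case
    using Cons.IH[of "drop 1 ys"] Cons.prems by (simp add: bvl_split[of ys])
qed simp

lemma pbool_bval_le:
  assumes f: "ptime f" and g: "ptime g"
  shows "pbool (\<lambda>x. bval (f x) \<le> bval (g x))"
proof -
  \<comment> \<open>The appended zeros make the first number at least as long as the second, as
    \<open>ble_loop\<close> requires. The initial verdict \<open>tt\<close> turns the strict
    comparison into \<open>\<le>\<close>.\<close>
  let ?L = "\<lambda>x. lst (f x) @ replicate (length (lst (g x))) NIL"
  have [simp]: "bvl (replicate n NIL) = 0" for n by (induction n) auto
  have s: "size (ble_step acc a) \<le> size acc + 10" for acc a
    by (cases acc; cases "car acc") (auto simp: ble_step_def Let_def)
  have "ptime (\<lambda>s. ble_step (car (cdr s)) (cdr (cdr s)))"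
    unfolding ble_step_def Let_def
    by (intro basic_intros ptime_If pbool_iff pbool_not pbool_NIL ptime_of_bit)
  then have "ptime (\<lambda>x. cdr (foldl ble_step (Cell (g x) tt) (?L x)))"
    by (intro ptime_cdr ptime_foldl_additive[where step = "\<lambda>_. ble_step", OF _ _ _ polyb_const s]
      basic_intros g ptime_enc_list plist_append plist_lst f plist_replicate_NIL pnat_length)
  moreover have "cdr (foldl ble_step (Cell (g x) tt) (?L x)) = of_bit (bval (f x) \<le> bval (g x))" for x
    using ble_loop[of "lst (g x)" "?L x" True]
    by (simp add: of_bit_def bvl_append le_less cong: if_cong)
  ultimately show ?thesis by (simp add: of_bit_def pbool_def)
qed

text \<open>Only the value matters, not the code: the numbers of the input are merely multiplied and
  compared.\<close>

definition pbin :: "(sexp \<Rightarrow> nat) \<Rightarrow> bool" where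
  "pbin f \<longleftrightarrow> (\<exists>g. ptime g \<and> (\<forall>x. f x = bval (g x)))"

lemma pbin_bval: "ptime f \<Longrightarrow> pbin (\<lambda>x. bval (f x))"
  unfolding pbin_def by blast

lemma pbin_mult:
  assumes "pbin f" "pbin g"
  shows "pbin (\<lambda>x. f x * g x)"
proof -
  from assms obtain f' g' where "ptime f'" "ptime g'" "\<And>x. f x = bval (f' x)" "\<And>x. g x = bval (g' x)"
    unfolding pbin_def by blast
  then show ?thesis unfolding pbin_def
    by (intro exI[of _ "\<lambda>x. bmul (lst (f' x)) (g' x)"]) (simp add: ptime_bmul plist_lst bval_bmul)
qed

lemma pbin_le:
  assumes "pbin f" "pbin g"
  shows "pbool (\<lambda>x. f x \<le> g x)"
proof -
  from assms obtain f' g' where "ptime f'" "ptime g'" "\<And>x. f x = bval (f' x)" "\<And>x. g x = bval (g' x)"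
    unfolding pbin_def by blast
  then show ?thesis by (simp add: pbool_bval_le)
qed

lemma pbin_eq: "pbin f \<Longrightarrow> pbin g \<Longrightarrow> pbool (\<lambda>x. f x = g x)"
  unfolding eq_iff by (intro pbool_conj pbin_le)

text \<open>Counts up from zero, \<open>Cell tt NIL\<close> being the number 1. Each addition
  lengthens the code even without overflow, so the bound on its length is linear, which is
  enough.\<close>

lemma pbin_pnat:
  assumes f: "pnat f"
  shows "pbin f"
proof -
  define h where "h n = foldl (\<lambda>acc _. enc_list (badd (Cell tt NIL) acc)) NIL (replicate n NIL)" for n
  have h: "bval (h n) = n \<and> digits (lst (h n)) \<and> length (lst (h n)) \<le> 1 + n" for n
    unfolding h_def
    by (induction n) (auto simp: bvl_badd digits_badd length_badd digits_Nil
        simp flip: replicate_append_same)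
  have s: "size (h n) \<le> 2 * (1 + n)" for n
    using size_digits[of "lst (h n)"] h[of n] by simp
  have "ptime (\<lambda>x. foldl (\<lambda>acc _. enc_list (badd (Cell tt NIL) acc)) NIL (replicate (f x) NIL))"
  proof (rule ptime_foldl)
    show "polyb (\<lambda>x. 2 * (1 + size (un (f x))))"
      by (intro polyb_intros ptime_size ptime_un f)
    fix x zs ws assume "replicate (f x) NIL = zs @ ws"
    then have "zs = replicate (length zs) NIL" "length zs \<le> f x"
      by (metis append_eq_conv_conj take_replicate length_replicate min.commute,
        metis le_add1 length_append length_replicate)
    then show "size (foldl (\<lambda>acc _. enc_list (badd (Cell tt NIL) acc)) NIL zs) \<le> 2 * (1 + size (un (f x)))"
      using s[of "length zs"] unfolding h_def by simp
  qed (intro basic_intros ptime_enc_list plist_badd plist_replicate_NIL f)+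
  then show ?thesis unfolding pbin_def
    using h by (intro exI[of _ "\<lambda>x. h (f x)"]) (simp add: h_def)
qed

section \<open>The algorithm\<close>

text \<open>The inequality \<open>g \<le> r * s\<close> with denominators cleared; the sign flags
  force both factors to be nonnegative. All length conditions of a route have this shape, with
  \<open>s\<close> the bound \<open>L\<close> and \<open>r\<close> one of 1, \<open>c\<close> and an
  entry of \<open>t\<close>.\<close>

definition rat_le :: "nat \<Rightarrow> sexp \<Rightarrow> sexp \<Rightarrow> bool" where
  "rat_le g r s \<longleftrightarrow> car (car r) = NIL \<and> car (car s) = NIL \<and>
     g * bval (cdr (cdr r)) * bval (cdr (cdr s)) \<le> bval (cdr (car r)) * bval (cdr (car s))"

lemma pbool_rat_le:
  assumes "pnat g" "ptime r" "ptime s"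
  shows "pbool (\<lambda>x. rat_le (g x) (r x) (s x))"
  unfolding rat_le_def
  by (intro pbool_conj pbool_NIL ptime_car ptime_cdr assms pbin_le pbin_mult pbin_pnat pbin_bval)

definition bin_le :: "nat \<Rightarrow> sexp \<Rightarrow> bool" where "bin_le n x \<longleftrightarrow> n \<le> bval x"

definition bin_eq :: "nat \<Rightarrow> sexp \<Rightarrow> bool" where "bin_eq n x \<longleftrightarrow> n = bval x"

lemma pbool_bin_le: "pnat g \<Longrightarrow> ptime f \<Longrightarrow> pbool (\<lambda>x. bin_le (g x) (f x))"
  unfolding bin_le_def by (intro pbin_le pbin_pnat pbin_bval)

lemma pbool_bin_eq: "pnat g \<Longrightarrow> ptime f \<Longrightarrow> pbool (\<lambda>x. bin_eq (g x) (f x))"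
  unfolding bin_eq_def by (intro pbin_eq pbin_pnat pbin_bval)

lemma pbool_member:
  assumes f: "ptime f" and L: "plist L"
  shows "pbool (\<lambda>x. f x \<in> set (L x))"
proof -
  have "pbool (\<lambda>x. \<exists>a\<in>set (L x). f x = a)"
    by (intro pbool_bex L pbool_eq ptime_comp[OF f] basic_intros)
  then show ?thesis by simp
qed

lemmas pt_intros =
  ptime_Cell ptime_car ptime_cdr ptime_id ptime_If ptime_enc_list ptime_nthd ptime_un
  plist_Nil plist_Cons plist_lst plist_append plist_map plist_concat_map plist_filter
  plist_filter_upt plist_map_upt plist_concat_map_upt
  pnat_const pnat_length pnat_add pnat_diff pnat_mult
  pbool_conj pbool_disj pbool_not pbool_imp pbool_ball pbool_bex pbool_all_less pbool_ex_less
  pbool_eq pbool_NIL pbool_nat_le pbool_nat_less pbool_nat_eq pbool_If pbool_member pbool_rat_le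
  pbool_bin_le pbool_bin_eq ptime_const

definition fld :: "nat \<Rightarrow> sexp \<Rightarrow> sexp" where "fld i x = nthd (lst x) i"

lemma ptime_fld: "ptime f \<Longrightarrow> ptime (\<lambda>x. fld i (f x))"
  unfolding fld_def by (intro pt_intros)

definition arc_list :: "sexp \<Rightarrow> sexp list" where
  "arc_list x = concat (map (\<lambda>e. [Cell (fld 0 e) (fld 1 e), Cell (fld 1 e) (fld 0 e)]) (lst (fld 1 x)))"

lemma plist_arc_list: "ptime f \<Longrightarrow> plist (\<lambda>x. arc_list (f x))"
  unfolding arc_list_def by (intro pt_intros ptime_fld)

text \<open>A word for a vertex \<open>v\<close> is what \<open>v\<close> sees of a walk of length \<open>l\<close>: the arcs of the walk
  that are incident with \<open>v\<close> at their positions, and \<open>NIL\<close> at all other positions.\<close>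

fun words :: "sexp \<Rightarrow> sexp \<Rightarrow> nat \<Rightarrow> nat \<Rightarrow> sexp list" where
  "words x v l 0 = [un l]"
| "words x v l (Suc k) = concat (map (\<lambda>y. y # concat (map (\<lambda>i.
     map (\<lambda>a. enc_list (map (\<lambda>j. if j = i then a else nthd (lst y) j) [0..<l]))
       (filter (\<lambda>a. car a = v \<or> cdr a = v) (arc_list x))) [0..<l]))
     (words x v l k))"

text \<open>The recursion on \<open>k\<close> takes place while the program is built, not while it
  runs. Each level multiplies the number of words by one plus \<open>l\<close> times the number of
  arcs at the vertex, which is polynomial because \<open>k\<close> is fixed.\<close>

lemma plist_words:
  assumes "ptime f" "ptime g" "pnat h"
  shows "plist (\<lambda>x. words (f x) (g x) (h x) k)"
proof (induction k)
  case 0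
  show ?case unfolding words.simps by (intro pt_intros assms)
next
  case (Suc k)
  show ?case unfolding words.simps
    by (intro pt_intros Suc plist_arc_list assms(1,2)[THEN ptime_comp] assms(3)[THEN pnat_comp] assms)
qed

text \<open>Seen from \<open>v\<close>, a closed walk from \<open>d\<close> leaves \<open>v\<close>
  right after entering it and enters \<open>v\<close> right before leaving it, except at its two
  ends. The backward condition later forces all vertices to see the same arc at a position; the last
  conjunct provides the first arc.\<close>

definition chain_ok :: "sexp \<Rightarrow> sexp \<Rightarrow> nat \<Rightarrow> (nat \<Rightarrow> sexp) \<Rightarrow> bool" where
  "chain_ok d v l y \<longleftrightarrow> (\<forall>i<l. y i \<noteq> NIL \<longrightarrow>
      (cdr (y i) = v \<longrightarrow> (if i + 1 < l then y (i + 1) \<noteq> NIL \<and> car (y (i + 1)) = v else v = d)) \<and>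
      (car (y i) = v \<longrightarrow> (if i = 0 then v = d else y (i - 1) \<noteq> NIL \<and> cdr (y (i - 1)) = v))) \<and>
    (v = d \<and> 0 < l \<longrightarrow> y 0 \<noteq> NIL \<and> car (y 0) = d)"

definition positions :: "nat \<Rightarrow> sexp \<Rightarrow> (nat \<Rightarrow> sexp) \<Rightarrow> nat list" where
  "positions l e y = filter (\<lambda>j. y j = Cell (fld 0 e) (fld 1 e) \<or> y j = Cell (fld 1 e) (fld 0 e)) [0..<l]"

text \<open>The detour through \<open>map un\<close> presents a count as the length of a
  polynomial-time list, to which the closure rules apply.\<close>

definition count_ok :: "nat \<Rightarrow> sexp \<Rightarrow> (nat \<Rightarrow> sexp) \<Rightarrow> bool" where
  "count_ok l e y \<longleftrightarrow> (\<forall>a\<in>set [Cell (fld 0 e) (fld 1 e), Cell (fld 1 e) (fld 0 e)].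
     1 \<le> length (map un (filter (\<lambda>j. y j = a) [0..<l])) \<and>
     bin_le (length (map un (filter (\<lambda>j. y j = a) [0..<l]))) (fld 3 e))"

text \<open>Row \<open>k\<close> of the table belongs to priority \<open>k + 1\<close> and column
  \<open>i - 1\<close> to the \<open>i\<close>-th gap. The row is searched for because the priority
  is given in binary.\<close>

definition gap_ok :: "sexp \<Rightarrow> nat \<Rightarrow> sexp \<Rightarrow> (nat \<Rightarrow> sexp) \<Rightarrow> bool" where
  "gap_ok x l e y \<longleftrightarrow> (\<forall>k<length (lst (fld 5 x)). bin_eq (k + 1) (fld 2 e) \<longrightarrow>
     (\<forall>i<length (map un (positions l e y)). 1 \<le> i \<longrightarrow>
       rat_le (length (lst (nthd (map un (positions l e y)) i)) -
           length (lst (nthd (map un (positions l e y)) (i - 1))) - 1)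
         (nthd (lst (nthd (lst (fld 5 x)) k)) (i - 1)) (fld 3 x)))"

text \<open>Meant for the view of the depot, where an entry is nonblank exactly if the step touches
  \<open>d\<close>; \<open>k\<close> and \<open>m\<close> are start and length of a
  sub-route.\<close>

definition window_ok :: "sexp \<Rightarrow> nat \<Rightarrow> (nat \<Rightarrow> sexp) \<Rightarrow> bool" where
  "window_ok x l y \<longleftrightarrow> (\<forall>k<l. \<forall>m<l + 1. 1 \<le> m \<and> k + m \<le> l \<and> \<not> rat_le m (fld 4 x) (fld 3 x) \<longrightarrow>
     (\<exists>i<m. y (k + i) \<noteq> NIL))"

definition local_ok :: "sexp \<Rightarrow> nat \<Rightarrow> sexp \<Rightarrow> sexp \<Rightarrow> bool" where
  "local_ok x l v y \<longleftrightarrow> chain_ok (fld 2 x) v l (nthd (lst y)) \<and>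
     (\<forall>e\<in>set (lst (fld 1 x)). fld 0 e = v \<or> fld 1 e = v \<longrightarrow>
        count_ok l e (nthd (lst y)) \<and> gap_ok x l e (nthd (lst y))) \<and>
     (v = fld 2 x \<longrightarrow> window_ok x l (nthd (lst y)))"

lemma pbool_local_ok:
  assumes "ptime f" "ptime g" "pnat h" "ptime k"
  shows "pbool (\<lambda>x. local_ok (f x) (h x) (g x) (k x))"
  unfolding local_ok_def chain_ok_def count_ok_def gap_ok_def positions_def window_ok_def
  by (intro pt_intros ptime_fld assms(1,2,4)[THEN ptime_comp] assms(3)[THEN pnat_comp] assms)

definition agree :: "sexp \<Rightarrow> sexp \<Rightarrow> nat \<Rightarrow> (nat \<Rightarrow> sexp) \<Rightarrow> (nat \<Rightarrow> sexp) \<Rightarrow> bool" where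
  "agree v w l y y' \<longleftrightarrow> (\<forall>i<l. y i = Cell v w \<or> y i = Cell w v \<or> y' i = Cell v w \<or> y' i = Cell w v
     \<longrightarrow> y i = y' i)"

definition init_state :: "sexp \<Rightarrow> nat \<Rightarrow> nat \<Rightarrow> sexp" where
  "init_state x K l = enc_list (map (\<lambda>v. Cell v (enc_list (filter (local_ok x l v) (words x v l K))))
     (lst (fld 0 x)))"

text \<open>All vertices are filtered against the state before the round, so the outcome does not
  depend on their order.\<close>

definition round_step :: "sexp \<Rightarrow> nat \<Rightarrow> sexp \<Rightarrow> sexp" where
  "round_step x l st = enc_list (map (\<lambda>p. Cell (car p) (enc_list (filter (\<lambda>y.
     \<forall>q\<in>set (lst st). Cell (car p) (car q) \<in> set (arc_list x) \<longrightarrow>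
       (\<exists>y'\<in>set (lst (cdr q)). agree (car p) (car q) l (nthd (lst y)) (nthd (lst y')))) (lst (cdr p)))))
     (lst st))"

text \<open>The vertex list of the fold is only a clock for \<open>card V\<close> rounds.\<close>

definition accept :: "sexp \<Rightarrow> nat \<Rightarrow> nat \<Rightarrow> bool" where
  "accept x K l \<longleftrightarrow> (\<forall>p\<in>set (lst (foldl (\<lambda>st _. round_step x l st) (init_state x K l) (lst (fld 0 x)))).
     cdr p \<noteq> NIL)"

definition decide :: "nat \<Rightarrow> nat \<Rightarrow> sexp \<Rightarrow> bool" where
  "decide F K x \<longleftrightarrow> (\<exists>l<2 * F * length (lst (fld 1 x)) + 1.
     rat_le l (enc_rat 1) (fld 3 x) \<and> accept x K l)"

section \<open>Polynomial time of the algorithm\<close>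

lemma size_filter_enc: "size (enc_list (filter P xs)) \<le> size (enc_list xs)"
  by (induction xs) auto

text \<open>Filtering shrinks the lists, but an entry \<open>NIL\<close> would be rebuilt as a
  larger \<open>Cell\<close>, hence the assumption.\<close>

lemma size_round_step:
  assumes "NIL \<notin> set (lst st)"
  shows "size (round_step x l st) \<le> size st"
proof -
  have "NIL \<notin> set xs \<Longrightarrow>
    size (enc_list (map (\<lambda>p. Cell (car p) (enc_list (filter (Q p) (lst (cdr p))))) xs))
    \<le> size (enc_list xs)" for Q :: "sexp \<Rightarrow> sexp \<Rightarrow> bool" and xs
  proof (induction xs)
    case (Cons p xs)
    then obtain a b where p: "p = Cell a b" by (cases p) auto
    have "size (enc_list (filter (Q p) (lst b))) \<le> size b"
      using size_filter_enc[of "Q p" "lst b"] by simp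
    with Cons p show ?case by simp
  qed simp
  from this[OF assms] show ?thesis by (simp add: round_step_def)
qed

lemma size_rounds:
  "NIL \<notin> set (lst st) \<Longrightarrow> size (foldl (\<lambda>st _. round_step x l st) st zs) \<le> size st"
proof (induction zs arbitrary: st)
  case (Cons z zs)
  have "NIL \<notin> set (lst (round_step x l st))" by (auto simp: round_step_def)
  from Cons.IH[OF this] size_round_step[OF Cons.prems, of x l] show ?case
    by (simp add: order_trans)
qed simp

lemma ptime_init_state:
  assumes "ptime f" "pnat h"
  shows "ptime (\<lambda>x. init_state (f x) K (h x))"
  unfolding init_state_def
  by (intro pt_intros ptime_fld pbool_local_ok plist_words
    assms(1)[THEN ptime_comp] assms(2)[THEN pnat_comp] assms)

lemma pbool_accept:
  assumes "ptime f" "pnat h"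
  shows "pbool (\<lambda>x. accept (f x) K (h x))"
proof -
  have "ptime (\<lambda>x. foldl (\<lambda>st _. round_step (f x) (h x) st) (init_state (f x) K (h x)) (lst (fld 0 (f x))))"
  proof (rule ptime_foldl)
    show "ptime (\<lambda>s. round_step (f (car s)) (h (car s)) (car (cdr s)))"
      unfolding round_step_def agree_def
      by (intro pt_intros ptime_fld plist_arc_list assms(1)[THEN ptime_comp] assms(2)[THEN pnat_comp])
    show "polyb (\<lambda>x. size (init_state (f x) K (h x)))"
      by (intro ptime_size ptime_init_state assms)
    fix x zs ws
    have "NIL \<notin> set (lst (init_state (f x) K (h x)))" by (auto simp: init_state_def)
    then show "size (foldl (\<lambda>st _. round_step (f x) (h x) st) (init_state (f x) K (h x)) zs)
      \<le> size (init_state (f x) K (h x))"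
      by (rule size_rounds)
  qed (intro ptime_init_state assms pt_intros ptime_fld)+
  then show ?thesis unfolding accept_def
    by (intro pt_intros)
qed

lemma pbool_decide: "pbool (decide F K)"
  unfolding decide_def
  by (intro pt_intros ptime_fld pbool_accept)

theorem poly_time_decidableI:
  assumes P: "pbool P" and R: "\<And>x b. (x, b) \<in> R \<Longrightarrow> b \<longleftrightarrow> P x"
  shows "poly_time_decidable R"
proof -
  let ?f = "\<lambda>x. if P x then tt else NIL"
  from P obtain Q e where "computes Q e ?f" unfolding pbool_def ptime_def by blast
  from computes_shift[OF this, of "[shift 1 e]" "[]"]
  have "computes (shift 1 e # map (shift 1) Q) (shift 1 e) ?f" by simp
  then obtain t where t: "polyb t"
    "\<And>x. \<exists>n\<le>t x. eval (shift 1 e # map (shift 1) Q) [x] (shift 1 e) (?f x) n"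
    unfolding computes_def by blast
  from t(1) obtain k where k: "\<And>x. t x \<le> (size x + 2) ^ k" unfolding polyb_def by blast
  \<comment> \<open>The added 2 pays for the initial call and its argument.\<close>
  define q :: "nat poly" where "q = [:2, 1:] ^ k + [:2:]"
  have "\<exists>y n. runs (shift 1 e # map (shift 1) Q) x y n \<and> n \<le> poly q (size x) \<and> (y \<noteq> NIL \<longleftrightarrow> b)"
    if xb: "(x, b) \<in> R" for x b
  proof -
    let ?P = "shift 1 e # map (shift 1) Q"
    from t(2)[of x] obtain n where n: "n \<le> t x" "eval ?P [x] (shift 1 e) (?f x) n" by blast
    have p: "eval ?P [x] (Param 0) x 1" using eval_Param[of ?P "[x]" 0] by simp
    have "runs ?P x (?f x) (1 + 0 + n + 1)"
      unfolding runs_def by (rule eval_Call[OF evals_Cons[OF p evals_Nil]]) (use n in simp_all)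
    moreover have "1 + 0 + n + 1 \<le> poly q (size x)"
      using n(1) k[of x] by (simp add: q_def add.commute)
    moreover have "?f x \<noteq> NIL \<longleftrightarrow> b" using R[OF xb] by simp
    ultimately show ?thesis by blast
  qed
  then show ?thesis unfolding poly_time_decidable_def by blast
qed

section \<open>Rooted trees\<close>

lemma awalk_sym_orientation:
  "pre_digraph.awalk (sym_orientation V E) u p v \<longleftrightarrow>
     u \<in> V \<and> set p \<subseteq> {(a, b). {a, b} \<in> E} \<and> pcas u p v"
  by (simp add: pre_digraph.awalk_def sym_orientation_def cas_with_proj_eq)

lemma pcas_suffix:
  "pcas c p b \<Longrightarrow> distinct (pawalk_verts c p) \<Longrightarrow> x \<in> set (pawalk_verts c p) \<Longrightarrow>
    \<exists>q. pcas x q b \<and> set q \<subseteq> set p \<and> distinct (pawalk_verts x q)"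
proof (induction p arbitrary: c)
  case Nil
  then show ?case by (intro exI[of _ "[]"]) simp
next
  case (Cons e p)
  show ?case
  proof (cases "x = c")
    case True
    with Cons.prems show ?thesis by (intro exI[of _ "e # p"]) simp
  next
    case False
    with Cons.prems Cons.IH[of "snd e"] show ?thesis by auto
  qed
qed

text \<open>Loop erasure: if the new first vertex already lies on the path, the suffix starting
  there is taken instead.\<close>

lemma rtrancl_pcas:
  assumes "(a, b) \<in> R\<^sup>*"
  shows "\<exists>p. pcas a p b \<and> set p \<subseteq> R \<and> distinct (pawalk_verts a p)"
  using assms
proof (induction rule: converse_rtrancl_induct)
  case base
  show ?case by (intro exI[of _ "[]"]) simp
next
  case (step a c)
  then obtain p where p: "pcas c p b" "set p \<subseteq> R" "distinct (pawalk_verts c p)" by blast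
  show ?case
  proof (cases "a \<in> set (pawalk_verts c p)")
    case True
    from pcas_suffix[OF p(1,3) True] p(2) show ?thesis by blast
  next
    case False
    with p step show ?thesis by (intro exI[of _ "(a, c) # p"]) auto
  qed
qed

lemma pcas_snoc:
  "pcas a p b \<Longrightarrow> pcas a (p @ [(b, v)]) v \<and> pawalk_verts a (p @ [(b, v)]) = pawalk_verts a p @ [v]"
  by (induction p arbitrary: a) auto

lemma pawalk_verts_subset: "set (pawalk_verts a p) \<subseteq> insert a (fst ` set p \<union> snd ` set p)"
  by (induction p arbitrary: a) auto

text \<open>A connection of two neighbours of \<open>v\<close> that avoids \<open>v\<close> closes
  up to a cycle through \<open>v\<close>; \<open>a \<noteq> b\<close> makes it at least 3
  long.\<close>

lemma tree_separates:
  assumes tree: "undirected_tree V E" and edges: "{v, a} \<in> E" "{v, b} \<in> E" "a \<noteq> b"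
  shows "(a, b) \<notin> {(x, y). {x, y} \<in> E \<and> x \<noteq> v \<and> y \<noteq> v}\<^sup>*"
proof
  assume "(a, b) \<in> {(x, y). {x, y} \<in> E \<and> x \<noteq> v \<and> y \<noteq> v}\<^sup>*"
  from rtrancl_pcas[OF this] obtain p where
    p: "pcas a p b" "set p \<subseteq> {(x, y). {x, y} \<in> E \<and> x \<noteq> v \<and> y \<noteq> v}" "distinct (pawalk_verts a p)"
    by blast
  from tree have sg: "\<And>e. e \<in> E \<Longrightarrow> e \<subseteq> V \<and> card e = 2"
    by (auto simp: undirected_tree_def simple_graph_def)
  from edges(1) sg have v: "v \<in> V" "v \<noteq> a" by fastforce+
  define C where "C = (v, a) # p @ [(b, v)]"
  have "v \<notin> fst ` set p \<union> snd ` set p" using p(2) by fastforce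
  then have "v \<notin> set (pawalk_verts a p)"
    using pawalk_verts_subset[of a p] v(2) by blast
  moreover have "pcas v C v" "tl (pawalk_verts v C) = pawalk_verts a p @ [v]"
    using pcas_snoc[OF p(1), of v] by (auto simp: C_def)
  moreover have "set C \<subseteq> {(a, b). {a, b} \<in> E}"
    using p(2) edges by (auto simp: C_def insert_commute)
  ultimately have "pre_digraph.cycle (sym_orientation V E) C"
    unfolding pre_digraph.cycle_def awalk_sym_orientation
    using v p(3) by (intro exI[of _ v])
      (auto simp: sym_orientation_def awalk_verts_with_proj_eq C_def)
  moreover have "p \<noteq> []" using p(1) edges(3) by auto
  then have "3 \<le> length C" by (cases p) (auto simp: C_def)
  ultimately show False using tree by (auto simp: undirected_tree_def)
qed

lemma tree_reachable:
  assumes tree: "undirected_tree V E" and uv: "u \<in> V" "v \<in> V"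
  shows "(u, v) \<in> {(x, y). {x, y} \<in> E}\<^sup>*"
proof -
  \<comment> \<open>Connectedness is defined through the symmetric closure, which leaves this
    orientation unchanged.\<close>
  have "parcs (mk_symmetric (sym_orientation V E)) = {(x, y). {x, y} \<in> E}"
    "pverts (mk_symmetric (sym_orientation V E)) = V"
    by (auto simp: mk_symmetric_def sym_orientation_def insert_commute)
  with tree uv have "(u, v) \<in> rtrancl_on V {(x, y). {x, y} \<in> E}"
    by (auto simp: undirected_tree_def connected_def strongly_connected_def reachable_def)
  then show ?thesis by (rule rtrancl_on_rtranclI)
qed

text \<open>\<open>depth\<close> is the distance to \<open>d\<close> and \<open>par\<close> picks a
  neighbour one step closer. Acyclicity is needed for the second claim, that every edge joins a
  vertex to its parent.\<close>

lemma tree_rank: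
  assumes tree: "undirected_tree V E" and d: "d \<in> V"
  obtains depth par where
    "\<And>v. v \<in> V \<Longrightarrow> v \<noteq> d \<Longrightarrow> {par v, v} \<in> E \<and> depth v = Suc (depth (par v))"
    "\<And>u v. {u, v} \<in> E \<Longrightarrow> v \<noteq> d \<and> u = par v \<or> u \<noteq> d \<and> v = par u"
    "\<And>v. v \<in> V \<Longrightarrow> depth v < card V"
    "\<And>v. v \<in> V \<Longrightarrow> depth v = 0 \<Longrightarrow> v = d" "depth d = 0"
proof -
  let ?A = "{(x, y). {x, y} \<in> E}"
  let ?R = "\<lambda>v. {(x, y). {x, y} \<in> E \<and> x \<noteq> v \<and> y \<noteq> v}"
  from tree have fin: "finite V" and sg: "\<And>e. e \<in> E \<Longrightarrow> e \<subseteq> V \<and> card e = 2"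
    by (auto simp: undirected_tree_def simple_graph_def)
  have neq: "u \<noteq> v" "u \<in> V" "v \<in> V" if "{u, v} \<in> E" for u v
    using sg[OF that] by auto
  define depth where "depth v = (LEAST n. (v, d) \<in> ?A ^^ n)" for v
  have ex: "(v, d) \<in> ?A ^^ depth v" if "v \<in> V" for v
    unfolding depth_def
    by (rule LeastI_ex) (use tree_reachable[OF tree that d] in \<open>simp add: rtrancl_power\<close>)
  have le: "depth v \<le> n" if "(v, d) \<in> ?A ^^ n" for v n
    unfolding depth_def using that by (rule Least_le)
  have d0: "depth d = 0" using le[of d 0] by simp
  have dz: "v = d" if "v \<in> V" "depth v = 0" for v using ex[OF that(1)] that(2) by simp
  have up: "\<exists>u. {u, v} \<in> E \<and> depth v = Suc (depth u)" if v: "v \<in> V" "v \<noteq> d" for v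
  proof -
    from dz v obtain n where n: "depth v = Suc n" by (cases "depth v") auto
    from ex[OF v(1)] n have "(v, d) \<in> ?A ^^ Suc n" by simp
    then obtain u where u: "(v, u) \<in> ?A" "(u, d) \<in> ?A ^^ n" by (meson relpow_Suc_E2)
    then have uV: "u \<in> V" using neq by auto
    from u(1) ex[OF uV] have "(v, d) \<in> ?A ^^ Suc (depth u)" by (rule relpow_Suc_I2)
    then have "depth v \<le> Suc (depth u)" by (rule le)
    moreover have "depth u \<le> n" by (rule le[OF u(2)])
    ultimately show ?thesis using n u(1) by (intro exI[of _ u]) (auto simp: insert_commute)
  qed
  define par where "par v = (SOME u. {u, v} \<in> E \<and> depth v = Suc (depth u))" for v
  have par: "{par v, v} \<in> E \<and> depth v = Suc (depth (par v))" if "v \<in> V" "v \<noteq> d" for v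
    unfolding par_def by (rule someI_ex[OF up[OF that]])
  \<comment> \<open>The path of parents has depth strictly below \<open>depth v\<close> from its
    second vertex on, so it cannot meet \<open>v\<close>.\<close>
  have avoid: "x \<in> V \<Longrightarrow> x \<noteq> v \<Longrightarrow> depth x \<le> depth v \<Longrightarrow> (x, d) \<in> (?R v)\<^sup>*" for x v
  proof (induction "depth x" arbitrary: x)
    case 0
    then show ?case using dz by auto
  next
    case (Suc n)
    then have "x \<noteq> d" using d0 by auto
    with Suc.prems par[of x] have p: "{par x, x} \<in> E" "depth x = Suc (depth (par x))" by auto
    with Suc have "par x \<noteq> v" by auto
    with p Suc neq[OF p(1)] have "(par x, d) \<in> (?R v)\<^sup>*" by auto
    moreover have "(x, par x) \<in> ?R v" using p \<open>par x \<noteq> v\<close> Suc.prems by (auto simp: insert_commute)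
    ultimately show ?case by (rule converse_rtrancl_into_rtrancl[rotated])
  qed
  \<comment> \<open>Otherwise \<open>u\<close> and \<open>par v\<close> would both reach
    \<open>d\<close> without passing \<open>v\<close>, against
    \<open>tree_separates\<close>.\<close>
  have child: "depth v < depth u" if uv: "{u, v} \<in> E" "v \<noteq> d" "u \<noteq> par v" for u v
  proof (rule ccontr)
    note n = neq[OF uv(1)]
    from par[OF n(3) uv(2)] have p: "{par v, v} \<in> E" "depth v = Suc (depth (par v))" by auto
    assume "\<not> depth v < depth u"
    then have "(u, d) \<in> (?R v)\<^sup>*" by (intro avoid n) auto
    moreover have "(par v, d) \<in> (?R v)\<^sup>*" using p neq[OF p(1)] by (intro avoid) auto
    moreover have "sym ((?R v)\<^sup>*)" by (intro sym_rtrancl) (auto simp: sym_def insert_commute)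
    ultimately have "(u, par v) \<in> (?R v)\<^sup>*" by (meson rtrancl_trans symD)
    moreover have "(u, par v) \<notin> (?R v)\<^sup>*"
      by (rule tree_separates[OF tree]) (use uv p in \<open>auto simp: insert_commute\<close>)
    ultimately show False by contradiction
  qed
  have edge: "v \<noteq> d \<and> u = par v \<or> u \<noteq> d \<and> v = par u" if uv: "{u, v} \<in> E" for u v
  proof -
    have vu: "{v, u} \<in> E" using uv by (simp add: insert_commute)
    show ?thesis using child[OF uv] child[OF vu] neq[OF uv] d0 by fastforce
  qed
  have "depth v < card V" if v: "v \<in> V" for v
  proof -
    \<comment> \<open>Climbing from \<open>v\<close> to the depot realises every depth up to
      \<open>depth v\<close>, so there are more than \<open>depth v\<close> vertices.\<close>
    have "n \<le> depth v \<Longrightarrow> n \<in> depth ` V" for n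
    proof (induction n rule: inc_induct)
      case base
      show ?case using v by blast
    next
      case (step n)
      then obtain w where w: "w \<in> V" "depth w = Suc n" by force
      then have "w \<noteq> d" using d0 by auto
      from par[OF w(1) this] w neq show ?case by (metis image_eqI nat.inject)
    qed
    then have "{..depth v} \<subseteq> depth ` V" by auto
    then have "card {..depth v} \<le> card (depth ` V)" using fin by (intro card_mono) auto
    also have "\<dots> \<le> card V" by (rule card_image_le[OF fin])
    finally show ?thesis by simp
  qed
  from that[OF par edge this dz d0] show thesis by blast
qed


section \<open>Correctness\<close>

lemma rat_le_enc_rat:
  "rat_le g (enc_rat r) (enc_rat s) \<longleftrightarrow> 0 \<le> r \<and> 0 \<le> s \<and> of_nat g \<le> r * s"
proof -
  obtain a b where q: "quotient_of r = (a, b)" by (cases "quotient_of r")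
  obtain a' b' where q': "quotient_of s = (a', b')" by (cases "quotient_of s")
  have b: "b > 0" "b' > 0" using quotient_of_denom_pos[OF q] quotient_of_denom_pos[OF q'] by auto
  have r: "r = of_int a / of_int b" "s = of_int a' / of_int b'"
    using quotient_of_div[OF q] quotient_of_div[OF q'] by auto
  have sgn: "0 \<le> r \<longleftrightarrow> 0 \<le> a" "0 \<le> s \<longleftrightarrow> 0 \<le> a'"
    using b by (auto simp: r zero_le_divide_iff)
  have "rat_le g (enc_rat r) (enc_rat s) \<longleftrightarrow> 0 \<le> a \<and> 0 \<le> a' \<and> g * nat \<bar>b\<bar> * nat \<bar>b'\<bar> \<le> nat \<bar>a\<bar> * nat \<bar>a'\<bar>"
    by (auto simp: rat_le_def enc_rat_def enc_int_def q q')
  also have "\<dots> \<longleftrightarrow> 0 \<le> a \<and> 0 \<le> a' \<and> int g * b * b' \<le> a * a'"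
  proof -
    have "g * nat \<bar>b\<bar> * nat \<bar>b'\<bar> \<le> nat \<bar>a\<bar> * nat \<bar>a'\<bar> \<longleftrightarrow> int g * b * b' \<le> a * a'"
      if "0 \<le> a" "0 \<le> a'"
    proof -
      have "int (g * nat \<bar>b\<bar> * nat \<bar>b'\<bar>) = int g * b * b'" "int (nat \<bar>a\<bar> * nat \<bar>a'\<bar>) = a * a'"
        using b that by auto
      then show ?thesis by (metis of_nat_le_iff)
    qed
    then show ?thesis by blast
  qed
  also have "int g * b * b' \<le> a * a' \<longleftrightarrow> of_nat g \<le> r * s"
  proof -
    have "of_nat g \<le> r * s \<longleftrightarrow> of_nat g * of_int b * of_int b' \<le> (of_int a * of_int a' :: rat)"
      using b by (simp add: r pos_le_divide_eq mult.assoc)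
    also have "\<dots> \<longleftrightarrow> of_int (int g * b * b') \<le> (of_int (a * a') :: rat)" by simp
    finally show ?thesis by (simp only: of_int_le_iff)
  qed
  finally show ?thesis by (simp add: sgn)
qed


section \<open>Views of a walk and the local tests\<close>

definition earc :: "nat \<times> nat \<Rightarrow> sexp" where
  "earc a = Cell (enc_nat (fst a)) (enc_nat (snd a))"

lemma earc_simps [simp]: "earc a = earc b \<longleftrightarrow> a = b" "earc a \<noteq> NIL" "NIL \<noteq> earc a"
  "car (earc a) = enc_nat (fst a)" "cdr (earc a) = enc_nat (snd a)"
  "Cell (enc_nat u) (enc_nat v) = earc (u, v)"
  by (auto simp: earc_def prod_eq_iff)

lemma in_edge_of: "v \<in> edge_of a \<longleftrightarrow> v = fst a \<or> v = snd a"
  by (cases a) auto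

definition view :: "nat \<Rightarrow> nat \<times> nat \<Rightarrow> sexp" where
  "view v a = (if v \<in> edge_of a then earc a else NIL)"

lemma view_simps: "view v a = NIL \<longleftrightarrow> v \<notin> edge_of a" "view v a = earc b \<longleftrightarrow> v \<in> edge_of a \<and> a = b"
  by (auto simp: view_def)

text \<open>Restates walks position by position, the form in which views describe them.\<close>

lemma pcas_iff:
  "pcas u w v \<longleftrightarrow> (if w = [] then u = v else fst (w ! 0) = u \<and> snd (w ! (length w - 1)) = v \<and>
     (\<forall>i. i + 1 < length w \<longrightarrow> snd (w ! i) = fst (w ! (i + 1))))"
proof (induction w arbitrary: u)
  case (Cons e w)
  show ?case
  proof (cases w)
    case (Cons b w')
    have "(\<forall>i. i + 1 < length (e # w) \<longrightarrow> snd ((e # w) ! i) = fst ((e # w) ! (i + 1))) \<longleftrightarrow>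
      snd e = fst (w ! 0) \<and> (\<forall>i. i + 1 < length w \<longrightarrow> snd (w ! i) = fst (w ! (i + 1)))"
      (is "?l \<longleftrightarrow> ?r")
    proof
      assume l: ?l
      from l[rule_format, of 0] l[rule_format, of "Suc _"] show ?r using Cons by auto
    next
      assume ?r
      then show ?l by (auto simp: nth_Cons split: nat.splits)
    qed
    moreover have "(e # w) ! (length (e # w) - 1) = w ! (length w - 1)" using Cons by simp
    ultimately show ?thesis
      unfolding pcas.simps Cons.IH[of "snd e"] using Cons by (simp only: list.simps if_False) auto
  qed simp
qed simp

lemma count_list_conv_nth: "count_list w a = length (filter (\<lambda>j. w ! j = a) [0..<length w])"
proof -
  have "count_list w a = length (filter (\<lambda>b. b = a) (map ((!) w) [0..<length w]))"
    unfolding map_nth by (induction w) auto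
  then show ?thesis by (simp add: filter_map comp_def)
qed

locale encoded_instance =
  fixes z \<Delta> F :: nat and V :: "nat set" and E d p L c t f x vs es
  assumes tree: "undirected_tree V E" and d: "d \<in> V"
    and p: "\<And>e. e \<in> E \<Longrightarrow> p e \<in> {1..z}"
    and deg: "\<And>v. v \<in> V \<Longrightarrow> degree_in E v \<le> \<Delta>"
    and f: "\<And>e. e \<in> E \<Longrightarrow> f e \<le> F"
    and t: "\<And>k i. k \<in> {1..z} \<Longrightarrow> i \<ge> 1 \<Longrightarrow> t k i > 0"
    and vs: "distinct vs" "set vs = V"
    and es: "distinct (map edge_of es)" "set (map edge_of es) = E"
    and x: "x = enc_list
          [enc_list (map enc_nat vs),
           enc_list (map (\<lambda>(u, v). enc_list
             [enc_nat u, enc_nat v, enc_nat (p {u, v}), enc_nat (f {u, v})]) es),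
           enc_nat d,
           enc_rat L,
           enc_rat c,
           enc_list (map (\<lambda>k. enc_list (map (\<lambda>i. enc_rat (t k i)) [1..<2 * F])) [1..<z + 1])]"
begin

definition A :: "(nat \<times> nat) set" where "A = {(u, v). {u, v} \<in> E}"

definition enc_edge :: "nat \<times> nat \<Rightarrow> sexp" where
  "enc_edge a = enc_list [enc_nat (fst a), enc_nat (snd a), enc_nat (p (edge_of a)), enc_nat (f (edge_of a))]"

lemma edge_in: "{u, v} \<in> E \<Longrightarrow> u \<in> V \<and> v \<in> V \<and> u \<noteq> v"
proof -
  assume "{u, v} \<in> E"
  then have "{u, v} \<subseteq> V \<and> card {u, v} = 2"
    using tree by (auto simp: undirected_tree_def simple_graph_def)
  then show ?thesis by auto
qed

lemma finite_V: "finite V" using vs by auto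
lemma finite_E: "finite E" using es by auto

lemma A_edge: "a \<in> A \<longleftrightarrow> edge_of a \<in> E"
  by (cases a) (simp add: A_def)

lemma A_swap: "(u, v) \<in> A \<Longrightarrow> (v, u) \<in> A"
  by (simp add: A_def insert_commute)

lemma A_in: "a \<in> A \<Longrightarrow> fst a \<in> V \<and> snd a \<in> V \<and> fst a \<noteq> snd a"
  using edge_in by (cases a) (auto simp: A_def)

lemma fld_x:
  "fld 0 x = enc_list (map enc_nat vs)" "fld 1 x = enc_list (map enc_edge es)"
  "fld 2 x = enc_nat d" "fld 3 x = enc_rat L" "fld 4 x = enc_rat c"
  "fld 5 x = enc_list (map (\<lambda>k. enc_list (map (\<lambda>i. enc_rat (t k i)) [1..<2 * F])) [1..<z + 1])"
proof -
  have "(\<lambda>(u, v). enc_list [enc_nat u, enc_nat v, enc_nat (p {u, v}), enc_nat (f {u, v})]) = enc_edge"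
    by (auto simp: enc_edge_def)
  then show "fld 1 x = enc_list (map enc_edge es)"
    unfolding fld_def x lst_enc_list by (simp add: nthd_def)
qed (unfold fld_def x lst_enc_list, simp_all add: nthd_def)

lemma fld_enc_edge:
  "fld 0 (enc_edge a) = enc_nat (fst a)" "fld 1 (enc_edge a) = enc_nat (snd a)"
  "fld 2 (enc_edge a) = enc_nat (p (edge_of a))" "fld 3 (enc_edge a) = enc_nat (f (edge_of a))"
  unfolding fld_def enc_edge_def lst_enc_list by (simp_all add: nthd_def)

lemma edge_of_swap: "edge_of (prod.swap a) = edge_of a"
  by (cases a) (simp add: insert_commute)

lemma edge_of_eq: "edge_of a = edge_of b \<longleftrightarrow> a = b \<or> a = prod.swap b"
  by (cases a; cases b) (auto simp: doubleton_eq_iff)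

text \<open>The encoding picks one orientation of each edge; listing both recovers all arcs
  whichever was picked.\<close>

lemma set_arc_list: "set (arc_list x) = earc ` A"
proof -
  have "set (arc_list x) = (\<Union>a\<in>set es. {earc a, earc (prod.swap a)})"
    unfolding arc_list_def fld_x lst_enc_list map_map comp_def fld_enc_edge
    by (auto simp: prod.swap_def)
  also have "\<dots> = earc ` A"
  proof (intro equalityI subsetI)
    fix s assume "s \<in> (\<Union>a\<in>set es. {earc a, earc (prod.swap a)})"
    then obtain a where "a \<in> set es" "s = earc a \<or> s = earc (prod.swap a)" by blast
    moreover from this have "edge_of a \<in> set (map edge_of es)" by simp
    ultimately show "s \<in> earc ` A" unfolding es(2) by (auto simp: A_edge edge_of_swap)
  next
    fix s assume "s \<in> earc ` A"
    then obtain a where "edge_of a \<in> E" "s = earc a" by (auto simp: A_edge)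
    then obtain b where b: "b \<in> set es" "edge_of a = edge_of b" using es(2) by auto
    with \<open>s = earc a\<close> show "s \<in> (\<Union>a\<in>set es. {earc a, earc (prod.swap a)})"
      unfolding edge_of_eq by auto
  qed
  finally show ?thesis .
qed

definition inc :: "nat \<Rightarrow> (nat \<times> nat) set" where "inc v = {a \<in> A. v \<in> edge_of a}"

lemma set_filter_arc_list:
  "set (filter (\<lambda>a. car a = enc_nat v \<or> cdr a = enc_nat v) (arc_list x)) = earc ` inc v"
  by (auto simp: set_arc_list inc_def in_edge_of)

lemma words_Suc: "Y \<in> set (words x (enc_nat v) l (Suc k)) \<longleftrightarrow>
    (\<exists>y\<in>set (words x (enc_nat v) l k). Y = y \<or> (\<exists>i<l. \<exists>a\<in>earc ` inc v.
      Y = enc_list (map (\<lambda>j. if j = i then a else nthd (lst y) j) [0..<l])))"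
proof -
  have "Y \<in> set (concat (map (\<lambda>y. y # concat (map (\<lambda>i. map (g y i) M) [0..<l])) W)) \<longleftrightarrow>
    (\<exists>y\<in>set W. Y = y \<or> (\<exists>i<l. \<exists>a\<in>set M. Y = g y i a))" for g :: "sexp \<Rightarrow> nat \<Rightarrow> sexp \<Rightarrow> sexp" and M W
  proof -
    have "set (concat (map (\<lambda>y. y # concat (map (\<lambda>i. map (g y i) M) [0..<l])) W)) =
      (\<Union>y\<in>set W. insert y (\<Union>i\<in>{0..<l}. g y i ` set M))"
      by simp
    then show ?thesis
      by (simp only: UN_iff insert_iff image_iff Bex_def atLeastLessThan_iff) simp
  qed
  then show ?thesis by (simp only: words.simps set_filter_arc_list)
qed

lemma words_sound:
  "Y \<in> set (words x (enc_nat v) l k) \<Longrightarrow>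
    length (lst Y) = l \<and> (\<forall>i<l. nthd (lst Y) i = NIL \<or> nthd (lst Y) i \<in> earc ` inc v)"
proof (induction k arbitrary: Y)
  case 0
  then show ?case by (auto simp: nthd_def un_def)
next
  case (Suc k)
  from Suc.prems obtain y where y: "y \<in> set (words x (enc_nat v) l k)"
    and "Y = y \<or> (\<exists>i<l. \<exists>a\<in>earc ` inc v.
      Y = enc_list (map (\<lambda>j. if j = i then a else nthd (lst y) j) [0..<l]))"
    unfolding words_Suc by blast
  then consider "Y = y" | i a where "a \<in> earc ` inc v"
    "Y = enc_list (map (\<lambda>j. if j = i then a else nthd (lst y) j) [0..<l])"
    by blast
  then show ?case using Suc.IH[OF y] by cases auto
qed

text \<open>The induction blanks one nonblank position, obtains the rest from level
  \<open>k\<close>, and writes the arc back at the last level.\<close>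

lemma words_complete:
  "length ys = l \<Longrightarrow> (\<forall>i<l. ys ! i = NIL \<or> ys ! i \<in> earc ` inc v) \<Longrightarrow>
    card {i. i < l \<and> ys ! i \<noteq> NIL} \<le> k \<Longrightarrow> enc_list ys \<in> set (words x (enc_nat v) l k)"
proof (induction k arbitrary: ys)
  case 0
  then have "ys = replicate l NIL" by (auto intro!: nth_equalityI)
  then show ?case by (simp add: un_def)
next
  case (Suc k)
  show ?case
  proof (cases "card {i. i < l \<and> ys ! i \<noteq> NIL} \<le> k")
    case True
    with Suc show ?thesis unfolding words_Suc by blast
  next
    case False
    then have "{i. i < l \<and> ys ! i \<noteq> NIL} \<noteq> {}" by force
    then obtain i where i: "i < l" "ys ! i \<noteq> NIL" by blast
    let ?ys = "ys[i := NIL]"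
    have "{j. j < l \<and> ?ys ! j \<noteq> NIL} = {j. j < l \<and> ys ! j \<noteq> NIL} - {i}"
      using i Suc.prems(1) by (auto simp: nth_list_update)
    then have "card {j. j < l \<and> ?ys ! j \<noteq> NIL} \<le> k" using i Suc.prems(3) by simp
    then have "enc_list ?ys \<in> set (words x (enc_nat v) l k)"
      using Suc.prems i by (intro Suc.IH) (auto simp: nth_list_update)
    moreover have "ys = map (\<lambda>j. if j = i then ys ! i else nthd (lst (enc_list ?ys)) j) [0..<l]"
      using i Suc.prems(1) by (intro nth_equalityI) (auto simp: nth_list_update)
    then have "enc_list ys = enc_list (map (\<lambda>j. if j = i then ys ! i else nthd (lst (enc_list ?ys)) j) [0..<l])"
      by (rule arg_cong)
    moreover have "ys ! i \<in> earc ` inc v" using Suc.prems(2) i by blast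
    ultimately show ?thesis unfolding words_Suc using i(1) by blast
  qed
qed

lemma walk_iff: "pre_digraph.awalk (sym_orientation V E) d w d \<longleftrightarrow> set w \<subseteq> A \<and> pcas d w d"
  using d by (simp add: awalk_sym_orientation A_def)

lemma chain_view:
  assumes "set w \<subseteq> A" "pcas d w d" "\<And>i. i < length w \<Longrightarrow> y i = view v (w ! i)"
  shows "chain_ok (enc_nat d) (enc_nat v) (length w) y"
proof -
  have p: "w \<noteq> [] \<Longrightarrow> fst (w ! 0) = d \<and> snd (w ! (length w - 1)) = d"
    "\<And>i. i + 1 < length w \<Longrightarrow> snd (w ! i) = fst (w ! (i + 1))"
    using assms(2) unfolding pcas_iff by (auto split: if_splits)
  have head: "if i + 1 < length w then y (i + 1) \<noteq> NIL \<and> car (y (i + 1)) = enc_nat v else enc_nat v = enc_nat d"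
    if i: "i < length w" "y i \<noteq> NIL" "cdr (y i) = enc_nat v" for i
  proof -
    from i have s: "snd (w ! i) = v" by (auto simp: assms(3) view_def split: if_splits)
    show ?thesis
    proof (cases "i + 1 < length w")
      case True
      from p(2)[OF this] s have "fst (w ! (i + 1)) = v" by simp
      then show ?thesis using True assms(3)[of "i + 1"] by (simp add: view_def in_edge_of)
    next
      case False
      with i have "i = length w - 1" "w \<noteq> []" by auto
      with s p(1) show ?thesis by auto
    qed
  qed
  have tail: "if i = 0 then enc_nat v = enc_nat d else y (i - 1) \<noteq> NIL \<and> cdr (y (i - 1)) = enc_nat v"
    if i: "i < length w" "y i \<noteq> NIL" "car (y i) = enc_nat v" for i
  proof -
    from i have s: "fst (w ! i) = v" by (auto simp: assms(3) view_def split: if_splits)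
    show ?thesis
    proof (cases "i = 0")
      case True
      with i s p(1) show ?thesis by auto
    next
      case False
      with p(2)[of "i - 1"] i s have "snd (w ! (i - 1)) = v" by auto
      then show ?thesis using False i assms(3)[of "i - 1"] by (simp add: view_def in_edge_of)
    qed
  qed
  have "y 0 \<noteq> NIL \<and> car (y 0) = enc_nat d" if "v = d" "0 < length w"
    using that p(1) assms(3)[of 0] by (auto simp: view_def in_edge_of)
  with head tail show ?thesis unfolding chain_ok_def enc_nat_inject by blast
qed


context
  fixes w :: "(nat \<times> nat) list" and v y
  assumes y: "\<And>i. i < length w \<Longrightarrow> y i = view v (w ! i)"
begin

lemma positions_view:
  assumes "v \<in> edge_of a"
  shows "positions (length w) (enc_edge a) y = traversals w (edge_of a)"
  unfolding positions_def traversals_def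
proof (rule filter_cong[OF refl])
  fix j assume "j \<in> set [0..<length w]"
  then have "y j = view v (w ! j)" by (simp add: y)
  then show "y j = Cell (fld 0 (enc_edge a)) (fld 1 (enc_edge a)) \<or>
      y j = Cell (fld 1 (enc_edge a)) (fld 0 (enc_edge a)) \<longleftrightarrow> edge_of (w ! j) = edge_of a"
    unfolding fld_enc_edge earc_simps edge_of_eq using assms
    by (cases a) (auto simp: view_simps in_edge_of)
qed

lemma count_view:
  assumes "v \<in> edge_of a"
  shows "length (filter (\<lambda>j. y j = earc a) [0..<length w]) = count_list w a"
proof -
  have "filter (\<lambda>j. y j = earc a) [0..<length w] = filter (\<lambda>j. w ! j = a) [0..<length w]"
    using assms by (intro filter_cong) (auto simp: y view_simps)
  then show ?thesis by (simp add: count_list_conv_nth)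
qed

lemma count_ok_view:
  assumes "v \<in> edge_of a"
  shows "count_ok (length w) (enc_edge a) y \<longleftrightarrow>
    (\<forall>b\<in>{a, prod.swap a}. 1 \<le> count_list w b \<and> count_list w b \<le> f (edge_of a))"
proof -
  have "v \<in> edge_of (snd a, fst a)" using assms by (auto simp: in_edge_of)
  with assms show ?thesis
    unfolding count_ok_def fld_enc_edge earc_simps length_map bin_le_def bval_enc_nat prod.swap_def
    by (simp add: count_view)
qed

text \<open>The table stores \<open>t\<close> for \<open>1 \<le> i < 2 * F\<close>, and
  \<open>len\<close> keeps every gap index within it. The sign tests of \<open>rat_le\<close> are
  met by \<open>0 \<le> L\<close> and the positivity of \<open>t\<close>.\<close>

lemma gap_ok_view:
  assumes v: "v \<in> edge_of a" and a: "edge_of a \<in> E" and L: "0 \<le> L"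
    and len: "length (traversals w (edge_of a)) \<le> 2 * F"
  shows "gap_ok x (length w) (enc_edge a) y \<longleftrightarrow>
    (\<forall>i. 1 \<le> i \<and> i < length (traversals w (edge_of a)) \<longrightarrow>
        of_nat (traversals w (edge_of a) ! i - traversals w (edge_of a) ! (i - 1) - 1) \<le> t (p (edge_of a)) i * L)"
proof -
  let ?T = "traversals w (edge_of a)"
  note pz = p[OF a]
  have "gap_ok x (length w) (enc_edge a) y \<longleftrightarrow>
    (\<forall>k<z. k + 1 = p (edge_of a) \<longrightarrow> (\<forall>i<length ?T. 1 \<le> i \<longrightarrow>
      rat_le (?T ! i - ?T ! (i - 1) - 1)
        (nthd (lst (nthd (map (\<lambda>k. enc_list (map (\<lambda>i. enc_rat (t k i)) [1..<2 * F])) [1..<z + 1]) k)) (i - 1))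
        (enc_rat L)))"
    unfolding gap_ok_def positions_view[OF v] fld_x fld_enc_edge lst_enc_list bin_eq_def bval_enc_nat
    by (simp del: upt_Suc)
  also have "\<dots> \<longleftrightarrow> (\<forall>i<length ?T. 1 \<le> i \<longrightarrow>
      rat_le (?T ! i - ?T ! (i - 1) - 1) (enc_rat (t (p (edge_of a)) i)) (enc_rat L))"
  proof -
    have "nthd (lst (nthd (map (\<lambda>k. enc_list (map (\<lambda>i. enc_rat (t k i)) [1..<2 * F])) [1..<z + 1]) k)) (i - 1)
      = enc_rat (t (k + 1) i)" if "k < z" "i < length ?T" "1 \<le> i" for k i
    proof -
      have "[1..<2 * F] ! (i - 1) = i" "i - 1 < 2 * F - 1"
        using that len by (auto simp: nth_upt)
      with that(1) show ?thesis by (simp del: upt_Suc)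
    qed
    moreover have "\<exists>k<z. k + 1 = p (edge_of a)"
      using pz by (intro exI[of _ "p (edge_of a) - 1"]) auto
    ultimately show ?thesis by (metis (no_types, lifting))
  qed
  also have "\<dots> \<longleftrightarrow> (\<forall>i. 1 \<le> i \<and> i < length ?T \<longrightarrow>
      of_nat (?T ! i - ?T ! (i - 1) - 1) \<le> t (p (edge_of a)) i * L)"
  proof -
    have "0 \<le> t (p (edge_of a)) i" if "1 \<le> i" for i using t[OF pz that] by simp
    then show ?thesis unfolding rat_le_enc_rat using L by blast
  qed
  finally show ?thesis .
qed

lemma window_ok_view:
  assumes v: "v = d" and L: "0 \<le> L"
  shows "window_ok x (length w) y \<longleftrightarrow>
     (\<forall>xs s ys. w = xs @ s @ ys \<and> s \<noteq> [] \<and> of_nat (length s) > c * L \<longrightarrow>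
        (\<exists>a \<in> set s. d \<in> edge_of a))"
proof -
  \<comment> \<open>A negative \<open>c\<close> fails the sign test, and rightly so: then
    \<open>c * L \<le> 0 < m\<close>, which uses \<open>1 \<le> m\<close>.\<close>
  have rl: "\<not> rat_le m (enc_rat c) (enc_rat L) \<longleftrightarrow> of_nat m > c * L" if "1 \<le> m" for m
  proof -
    have "0 \<le> c" if "of_nat m \<le> c * L"
    proof (rule ccontr)
      assume "\<not> 0 \<le> c"
      then have "c * L \<le> 0" using L by (simp add: mult_nonpos_nonneg)
      with that \<open>1 \<le> m\<close> show False by simp
    qed
    then show ?thesis unfolding rat_le_enc_rat using L by (metis not_le)
  qed
  have yk: "y (k + i) \<noteq> NIL \<longleftrightarrow> d \<in> edge_of (w ! (k + i))" if "k + i < length w" for k i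
    using y[OF that] by (simp add: view_simps v)
  show ?thesis
  proof
    assume ok: "window_ok x (length w) y"
    show "\<forall>xs s ys. w = xs @ s @ ys \<and> s \<noteq> [] \<and> of_nat (length s) > c * L \<longrightarrow>
        (\<exists>a \<in> set s. d \<in> edge_of a)"
    proof (intro allI impI, elim conjE)
      fix xs s ys assume w: "w = xs @ s @ ys" "s \<noteq> []" "of_nat (length s) > c * L"
      then have "length xs < length w" "length s < length w + 1" "1 \<le> length s"
        "length xs + length s \<le> length w"
        by (auto simp: Suc_le_eq)
      then obtain i where i: "i < length s" "y (length xs + i) \<noteq> NIL"
        using ok rl[of "length s"] w(3) unfolding window_ok_def fld_x by blast
      then have "d \<in> edge_of (w ! (length xs + i))" using yk w(1) by simp
      then show "\<exists>a \<in> set s. d \<in> edge_of a" using i(1) w(1) by (auto simp: nth_append)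
    qed
  next
    assume win: "\<forall>xs s ys. w = xs @ s @ ys \<and> s \<noteq> [] \<and> of_nat (length s) > c * L \<longrightarrow>
        (\<exists>a \<in> set s. d \<in> edge_of a)"
    show "window_ok x (length w) y"
      unfolding window_ok_def fld_x
    proof (intro allI impI, elim conjE)
      fix k m assume m: "1 \<le> m" "k + m \<le> length w" "\<not> rat_le m (enc_rat c) (enc_rat L)"
      let ?s = "take m (drop k w)"
      have "w = take k w @ ?s @ drop m (drop k w)" by (simp only: append_take_drop_id)
      moreover have "?s \<noteq> []" "length ?s = m" using m by auto
      ultimately obtain a where "a \<in> set ?s" "d \<in> edge_of a"
        using win[rule_format, of "take k w" ?s "drop m (drop k w)"] rl[OF m(1)] m(3) by auto
      then obtain i where "i < m" "d \<in> edge_of (w ! (k + i))"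
        using m(2) by (auto simp: in_set_conv_nth)
      then show "\<exists>i<m. y (k + i) \<noteq> NIL" using yk[of k i] m(2) by auto
    qed
  qed
qed

end

lemma length_traversals:
  "length (traversals w (edge_of a)) \<le> count_list w a + count_list w (prod.swap a)"
proof -
  have "length (filter (\<lambda>j. P j \<or> Q j) xs) \<le> length (filter P xs) + length (filter Q xs)" for P Q and xs :: "nat list"
    by (induction xs) auto
  moreover have "traversals w (edge_of a) = filter (\<lambda>j. w ! j = a \<or> w ! j = prod.swap a) [0..<length w]"
    unfolding traversals_def edge_of_eq ..
  ultimately show ?thesis by (simp add: count_list_conv_nth)
qed

end

context encoded_instance
begin

section \<open>Local tests against the conditions on a route\<close>

definition gaps_ok :: "(nat \<times> nat) list \<Rightarrow> nat set \<Rightarrow> bool" where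
  "gaps_ok w e \<longleftrightarrow> (\<forall>i. 1 \<le> i \<and> i < length (traversals w e) \<longrightarrow>
     of_nat (traversals w e ! i - traversals w e ! (i - 1) - 1) \<le> t (p e) i * L)"

definition windows_ok :: "(nat \<times> nat) list \<Rightarrow> bool" where
  "windows_ok w \<longleftrightarrow> (\<forall>xs s ys. w = xs @ s @ ys \<and> s \<noteq> [] \<and> of_nat (length s) > c * L \<longrightarrow>
        (\<exists>a \<in> set s. d \<in> edge_of a))"

definition counts_ok :: "(nat \<times> nat) list \<Rightarrow> nat set \<Rightarrow> bool" where
  "counts_ok w e \<longleftrightarrow> (\<forall>a. edge_of a = e \<longrightarrow> 1 \<le> count_list w a \<and> count_list w a \<le> f e)"

lemma vehicle_route_iff:
  "vehicle_route V E d p L c t f w \<longleftrightarrow> set w \<subseteq> A \<and> pcas d w d \<and> of_nat (length w) \<le> L \<and>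
     (\<forall>e\<in>E. counts_ok w e \<and> gaps_ok w e) \<and> windows_ok w"
proof -
  have "arcs (sym_orientation V E) = A" by (simp add: sym_orientation_def A_def)
  moreover have "(\<forall>a\<in>A. 1 \<le> count_list w a \<and> count_list w a \<le> f (edge_of a)) \<longleftrightarrow> (\<forall>e\<in>E. counts_ok w e)"
    unfolding counts_ok_def A_edge Ball_def by auto
  ultimately show ?thesis
    unfolding vehicle_route_def walk_iff gaps_ok_def windows_ok_def by blast
qed

lemma local_ok_view:
  assumes L: "0 \<le> L" and y: "lst Y = map (view v) w"
  shows "local_ok x (length w) (enc_nat v) Y \<longleftrightarrow>
    chain_ok (enc_nat d) (enc_nat v) (length w) (nthd (lst Y)) \<and>
    (\<forall>e\<in>E. v \<in> e \<longrightarrow> counts_ok w e \<and> gaps_ok w e) \<and> (v = d \<longrightarrow> windows_ok w)"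
proof -
  have yi: "nthd (lst Y) i = view v (w ! i)" if "i < length w" for i using that y by simp
  have edge: "count_ok (length w) (enc_edge a) (nthd (lst Y)) \<and> gap_ok x (length w) (enc_edge a) (nthd (lst Y))
    \<longleftrightarrow> counts_ok w (edge_of a) \<and> gaps_ok w (edge_of a)"
    if v: "v \<in> edge_of a" and a: "edge_of a \<in> E" for a
  proof -
    have c: "count_ok (length w) (enc_edge a) (nthd (lst Y)) \<longleftrightarrow> counts_ok w (edge_of a)"
      using count_ok_view[of w "nthd (lst Y)" v a, OF yi v] unfolding counts_ok_def edge_of_eq by blast
    \<comment> \<open>The counts bound the number of traversals by \<open>2 * F\<close>, so the gap
      tests are compared under the assumption of correct counts. This suffices for the equivalence
      of the conjunctions.\<close>
    moreover have "gap_ok x (length w) (enc_edge a) (nthd (lst Y)) \<longleftrightarrow> gaps_ok w (edge_of a)"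
      if cnt: "counts_ok w (edge_of a)"
    proof -
      have "count_list w b \<le> F" if "edge_of b = edge_of a" for b
        using cnt f[OF a] that unfolding counts_ok_def by (meson order_trans)
      from this[OF refl] this[OF edge_of_swap] have "length (traversals w (edge_of a)) \<le> 2 * F"
        using length_traversals[of w a] by simp
      from gap_ok_view[OF yi v a L this] show ?thesis unfolding gaps_ok_def .
    qed
    ultimately show ?thesis by blast
  qed
  have "(\<forall>e\<in>set (lst (fld 1 x)). fld 0 e = enc_nat v \<or> fld 1 e = enc_nat v \<longrightarrow>
        count_ok (length w) e (nthd (lst Y)) \<and> gap_ok x (length w) e (nthd (lst Y))) \<longleftrightarrow>
    (\<forall>a\<in>set es. v \<in> edge_of a \<longrightarrow> counts_ok w (edge_of a) \<and> gaps_ok w (edge_of a))"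
    unfolding fld_x lst_enc_list set_map ball_simps fld_enc_edge enc_nat_inject
    using edge es(2) by (auto simp: in_edge_of)
  also have "\<dots> \<longleftrightarrow> (\<forall>e\<in>set (map edge_of es). v \<in> e \<longrightarrow> counts_ok w e \<and> gaps_ok w e)"
    by auto
  finally show ?thesis
    unfolding local_ok_def fld_x(3) enc_nat_inject es(2)
    using window_ok_view[OF yi _ L] unfolding windows_ok_def by blast
qed

text \<open>The lists held by the state after \<open>n\<close> rounds, detached from their
  encoding.\<close>

primrec ws :: "nat \<Rightarrow> nat \<Rightarrow> nat \<Rightarrow> nat \<Rightarrow> sexp list" where
  "ws K l 0 = (\<lambda>v. filter (local_ok x l (enc_nat v)) (words x (enc_nat v) l K))"
| "ws K l (Suc n) = (\<lambda>v. filter (\<lambda>Y. \<forall>u\<in>V. (v, u) \<in> A \<longrightarrow> (\<exists>Y'\<in>set (ws K l n u).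
     agree (enc_nat v) (enc_nat u) l (nthd (lst Y)) (nthd (lst Y')))) (ws K l n v))"

lemma rounds:
  "foldl (\<lambda>st _. round_step x l st) (init_state x K l) zs =
    enc_list (map (\<lambda>v. Cell (enc_nat v) (enc_list (ws K l (length zs) v))) vs)"
proof (induction zs rule: rev_induct)
  case Nil
  show ?case unfolding foldl.simps init_state_def fld_x lst_enc_list by (simp add: comp_def)
next
  case (snoc z zs)
  have arc: "Cell (enc_nat u) (enc_nat v) \<in> set (arc_list x) \<longleftrightarrow> (u, v) \<in> A" for u v
    by (auto simp: set_arc_list)
  have "round_step x l (enc_list (map (\<lambda>v. Cell (enc_nat v) (enc_list (W v))) vs)) =
    enc_list (map (\<lambda>v. Cell (enc_nat v) (enc_list (filter (\<lambda>Y. \<forall>u\<in>V. (v, u) \<in> A \<longrightarrow> (\<exists>Y'\<in>set (W u).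
     agree (enc_nat v) (enc_nat u) l (nthd (lst Y)) (nthd (lst Y')))) (W v)))) vs)" for W
    unfolding round_step_def lst_enc_list map_map comp_def
      set_map ball_simps car.simps cdr.simps arc vs(2) by simp
  with snoc.IH show ?case by (simp only: foldl_append foldl.simps length_append ws.simps list.size) simp
qed

lemma accept_iff: "accept x K l \<longleftrightarrow> (\<forall>v\<in>V. ws K l (card V) v \<noteq> [])"
proof -
  have "length vs = card V" using distinct_card[OF vs(1)] vs(2) by simp
  moreover have "enc_list xs = NIL \<longleftrightarrow> xs = []" for xs by (cases xs) auto
  ultimately show ?thesis
    unfolding accept_def rounds unfolding fld_x lst_enc_list set_map ball_simps cdr.simps vs(2)
    by simp
qed

section \<open>From surviving views to a walk\<close>

lemma ws_antimono: "set (ws K l n v) \<subseteq> set (ws K l 0 v)"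
  by (induction n) auto

text \<open>Views are chosen by increasing depth. Every edge joins a vertex to its parent, so a new
  view has to agree with a single view chosen before, and agreement along all edges results.\<close>

lemma accept_family:
  assumes "accept x K l"
  obtains Y where "\<And>v. v \<in> V \<Longrightarrow> Y v \<in> set (ws K l 0 v)"
    "\<And>u v. (u, v) \<in> A \<Longrightarrow> agree (enc_nat u) (enc_nat v) l (nthd (lst (Y u))) (nthd (lst (Y v)))"
proof -
  obtain depth par where
    par: "\<And>v. v \<in> V \<Longrightarrow> v \<noteq> d \<Longrightarrow> {par v, v} \<in> E \<and> depth v = Suc (depth (par v))"
    and edge: "\<And>u v. {u, v} \<in> E \<Longrightarrow> v \<noteq> d \<and> u = par v \<or> u \<noteq> d \<and> v = par u"
    and depth: "\<And>v. v \<in> V \<Longrightarrow> depth v < card V"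
    and root: "\<And>v. v \<in> V \<Longrightarrow> depth v = 0 \<Longrightarrow> v = d" "depth d = 0"
    by (rule tree_rank[OF tree d]) blast
  define ag where "ag u v Y Y' = agree (enc_nat u) (enc_nat v) l (nthd (lst Y)) (nthd (lst Y'))"
    for u v Y Y'
  have "\<exists>Y. (\<forall>v\<in>V. depth v \<le> k \<longrightarrow> Y v \<in> set (ws K l (card V - depth v) v) \<and>
    (v \<noteq> d \<longrightarrow> ag (par v) v (Y (par v)) (Y v)))" for k
  proof (induction k)
    case 0
    from assms d obtain Y where "Y \<in> set (ws K l (card V) d)"
      unfolding accept_iff by (metis list.set_sel(1))
    then show ?case using root by (intro exI[of _ "\<lambda>_. Y"]) auto
  next
    case (Suc k)
    then obtain Y where Y: "\<And>v. v \<in> V \<Longrightarrow> depth v \<le> k \<Longrightarrow> Y v \<in> set (ws K l (card V - depth v) v) \<and>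
      (v \<noteq> d \<longrightarrow> ag (par v) v (Y (par v)) (Y v))" by blast
    \<comment> \<open>Only the views at the new depth are chosen; their parents already have
      one.\<close>
    define Y' where "Y' v = (if depth v \<le> k then Y v else
      (SOME y. y \<in> set (ws K l (card V - depth v) v) \<and> ag (par v) v (Y (par v)) y))" for v
    have "Y' v \<in> set (ws K l (card V - depth v) v) \<and> (v \<noteq> d \<longrightarrow> ag (par v) v (Y' (par v)) (Y' v))"
      if v: "v \<in> V" "depth v \<le> Suc k" for v
    proof (cases "depth v \<le> k")
      case True
      with Y[OF v(1) True] par[OF v(1)] show ?thesis by (auto simp: Y'_def)
    next
      case False
      with v(2) root have dv: "depth v = Suc k" "v \<noteq> d" by auto
      from par[OF v(1) dv(2)] dv have e: "{par v, v} \<in> E" "depth (par v) = k" by auto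
      from edge_in[OF e(1)] have pV: "par v \<in> V" by blast
      from Y[OF pV] e have "Y (par v) \<in> set (ws K l (card V - k) (par v))" by simp
      \<comment> \<open>By \<open>depth v < card V\<close> the subtraction is not truncated: the
        list at the parent is one round ahead of the list at the child.\<close>
      moreover have "card V - k = Suc (card V - Suc k)" using depth[OF v(1)] dv by simp
      ultimately have "\<exists>y. y \<in> set (ws K l (card V - depth v) v) \<and> ag (par v) v (Y (par v)) y"
        using v(1) e dv by (auto simp: ag_def A_def)
      from someI_ex[OF this] show ?thesis using False e by (simp add: Y'_def)
    qed
    then show ?case by blast
  qed
  from this[of "card V"] depth obtain Y where
    Y: "\<And>v. v \<in> V \<Longrightarrow> Y v \<in> set (ws K l (card V - depth v) v)"
      "\<And>v. v \<in> V \<Longrightarrow> v \<noteq> d \<Longrightarrow> ag (par v) v (Y (par v)) (Y v)"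
    using less_imp_le by metis
  show thesis
  proof (rule that)
    show "Y v \<in> set (ws K l 0 v)" if "v \<in> V" for v using Y(1)[OF that] ws_antimono by blast
    fix u v assume uv: "(u, v) \<in> A"
    have sym: "agree a b l y y' \<Longrightarrow> agree b a l y' y" for a b y y'
      unfolding agree_def by metis
    from uv edge[of u v] edge_in[of u v] Y(2)[of u] Y(2)[of v]
    show "agree (enc_nat u) (enc_nat v) l (nthd (lst (Y u))) (nthd (lst (Y v)))"
      unfolding A_def ag_def using sym by auto
  qed
qed

text \<open>The walk is read off from the depot on: \<open>g (Suc i)\<close> is what the head of
  \<open>g i\<close> sees at the next position. The crux is that no vertex sees a different arc
  there, which holds by induction on the position.\<close>

lemma family_walk:
  assumes inc: "\<And>v i. v \<in> V \<Longrightarrow> i < l \<Longrightarrow> y v i = NIL \<or> y v i \<in> earc ` inc v"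
    and chain: "\<And>v. v \<in> V \<Longrightarrow> chain_ok (enc_nat d) (enc_nat v) l (y v)"
    and ag: "\<And>u v. (u, v) \<in> A \<Longrightarrow> agree (enc_nat u) (enc_nat v) l (y u) (y v)"
  obtains w where "length w = l" "set w \<subseteq> A" "pcas d w d"
    "\<And>v i. v \<in> V \<Longrightarrow> i < l \<Longrightarrow> y v i = view v (w ! i)"
proof -
  have inc': "y v i = NIL \<or> (\<exists>a\<in>A. v \<in> edge_of a \<and> y v i = earc a)" if "v \<in> V" "i < l" for v i
    using inc[OF that] by (auto simp: inc_def)
  \<comment> \<open>Agreement along the edge shows an arc to both of its endpoints once one of them
    sees it.\<close>
  have arc: "a \<in> A \<and> y (fst a) i = earc a \<and> y (snd a) i = earc a"
    if "v \<in> V" "i < l" "y v i = earc a" for v i a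
  proof -
    from inc'[OF that(1,2)] that(3) have a: "a \<in> A" "v \<in> edge_of a" by auto
    obtain b b' where bb: "a = (b, b')" by (cases a)
    from a(1) bb have "(b, b') \<in> A" "(b', b) \<in> A" by (auto intro: A_swap)
    from ag[OF this(1)] ag[OF this(2)] a that bb show ?thesis
      unfolding agree_def in_edge_of earc_simps by (metis fst_conv snd_conv)
  qed
  have head: "if i + 1 < l then \<exists>a. y (snd a') (i + 1) = earc a \<and> fst a = snd a' else snd a' = d"
    if a: "v \<in> V" "i < l" "y v i = earc a'" for v i a'
  proof -
    from arc[OF a] have b: "snd a' \<in> V" "y (snd a') i = earc a'" using A_in by auto
    from chain[OF b(1)] b(2) a(2) have "if i + 1 < l then y (snd a') (i + 1) \<noteq> NIL \<and>
      car (y (snd a') (i + 1)) = enc_nat (snd a') else enc_nat (snd a') = enc_nat d"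
      unfolding chain_ok_def by (metis earc_simps(2,5))
    with inc'[OF b(1), of "i + 1"] show ?thesis by (auto split: if_splits)
  qed
  have tail: "if i = 0 then fst a' = d else \<exists>a. y (fst a') (i - 1) = earc a \<and> snd a = fst a'"
    if a: "v \<in> V" "i < l" "y v i = earc a'" for v i a'
  proof -
    from arc[OF a] have b: "fst a' \<in> V" "y (fst a') i = earc a'" using A_in by auto
    from chain[OF b(1)] b(2) a(2) have "if i = 0 then enc_nat (fst a') = enc_nat d else
      y (fst a') (i - 1) \<noteq> NIL \<and> cdr (y (fst a') (i - 1)) = enc_nat (fst a')"
      unfolding chain_ok_def by (metis earc_simps(2,4))
    moreover have "i - 1 < l" using a(2) by simp
    ultimately show ?thesis using inc'[OF b(1), of "i - 1"] by (auto split: if_splits)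
  qed
  define dec where "dec s = (THE a. s = earc a)" for s
  have dec [simp]: "dec (earc a) = a" for a by (simp add: dec_def)
  define g where "g = rec_nat (dec (y d 0)) (\<lambda>i a. dec (y (snd a) (Suc i)))"
  have g: "g 0 = dec (y d 0)" "g (Suc i) = dec (y (snd (g i)) (Suc i))" for i
    by (simp_all add: g_def)
  have main: "g i \<in> A \<and> y (fst (g i)) i = earc (g i) \<and> y (snd (g i)) i = earc (g i) \<and>
    (\<forall>v\<in>V. \<forall>a. y v i = earc a \<longrightarrow> a = g i) \<and>
    fst (g i) = (if i = 0 then d else snd (g (i - 1)))" if "i < l" for i
    using that
  proof (induction i)
    case 0
    from chain[OF d] 0 have "y d 0 \<noteq> NIL" "car (y d 0) = enc_nat d"
      unfolding chain_ok_def by auto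
    with inc'[OF d 0] obtain a where a: "y d 0 = earc a" "fst a = d" by auto
    have g0: "g 0 = a" using a by (simp add: g)
    have "b = a" if b: "v \<in> V" "y v 0 = earc b" for v b
      using tail[OF b(1) 0 b(2)] arc[OF b(1) 0 b(2)] a by auto
    then show ?case using arc[OF d 0 a(1)] a g0 by auto
  next
    case (Suc i)
    then have i: "i < l" and IH: "g i \<in> A" "y (snd (g i)) i = earc (g i)"
      "\<And>v a. v \<in> V \<Longrightarrow> y v i = earc a \<Longrightarrow> a = g i" by auto
    have sV: "snd (g i) \<in> V" using A_in[OF IH(1)] by simp
    from head[OF sV i IH(2)] Suc.prems obtain a where
      a: "y (snd (g i)) (Suc i) = earc a" "fst a = snd (g i)" by auto
    have gS: "g (Suc i) = a" using a by (simp add: g)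
    \<comment> \<open>The chain condition gives \<open>b\<close> a predecessor at position
      \<open>i\<close>, which can only be \<open>g i\<close>. So \<open>b\<close> leaves the same
      vertex as \<open>a\<close>, and that vertex sees one arc per position.\<close>
    have "b = a" if b: "v \<in> V" "y v (Suc i) = earc b" for v b
    proof -
      from tail[OF b(1) Suc.prems b(2)] obtain a' where a': "y (fst b) i = earc a'" "snd a' = fst b"
        by auto
      note ab = arc[OF b(1) Suc.prems b(2)]
      then have "fst b \<in> V" using A_in by blast
      from IH(3)[OF this a'(1)] a' have "fst b = snd (g i)" by simp
      with ab a show ?thesis by auto
    qed
    then show ?case using arc[OF sV Suc.prems a(1)] a gS by auto
  qed
  let ?w = "map g [0..<l]"
  show thesis
  proof (rule that)
    show "length ?w = l" by simp
    show "set ?w \<subseteq> A" using main by auto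
    \<comment> \<open>At the last position the chain condition admits no head but the depot.\<close>
    have "snd (g (l - 1)) = d" if "0 < l"
    proof -
      have l: "l - 1 < l" using that by simp
      with main[OF l] A_in have "snd (g (l - 1)) \<in> V" "y (snd (g (l - 1))) (l - 1) = earc (g (l - 1))" by auto
      from head[OF this(1) l this(2)] that show ?thesis by simp
    qed
    then show "pcas d ?w d" unfolding pcas_iff using main by (auto simp: Suc_less_eq)
    fix v i assume v: "v \<in> V" "i < l"
    show "y v i = view v (?w ! i)"
    proof (cases "y v i = NIL")
      \<comment> \<open>A blank entry cannot conceal an incident arc, since both endpoints of
        \<open>g i\<close> see it.\<close>
      case True
      with main[OF v(2)] have "v \<notin> edge_of (g i)" by (auto simp: in_edge_of)
      with True v(2) show ?thesis by (simp add: view_def)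
    next
      case False
      with inc'[OF v] obtain a where "v \<in> edge_of a" "y v i = earc a" by blast
      moreover from this main[OF v(2)] v(1) have "a = g i" by blast
      ultimately show ?thesis using v(2) by (simp add: view_def)
    qed
  qed
qed

section \<open>Bounds on routes and correctness of the decision\<close>

lemma finite_A: "finite A"
  by (rule finite_subset[of _ "V \<times> V"]) (use A_in finite_V in force)+

lemma count_le_F:
  assumes "\<forall>e\<in>E. counts_ok w e" "edge_of a \<in> E"
  shows "count_list w a \<le> F"
proof -
  from assms have "count_list w a \<le> f (edge_of a)" unfolding counts_ok_def by blast
  also have "\<dots> \<le> F" by (rule f[OF assms(2)])
  finally show ?thesis .
qed

text \<open>Justifies the search range of \<open>decide\<close>: an edge has two arcs, each used at
  most \<open>F\<close> times.\<close>

lemma length_route: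
  assumes "set w \<subseteq> A" "\<forall>e\<in>E. counts_ok w e"
  shows "length w \<le> 2 * F * length es"
proof -
  have "length w = (\<Sum>a\<in>A. count_list w a)" by (rule sum_count_set[OF assms(1) finite_A, symmetric])
  also have "\<dots> \<le> (\<Sum>a\<in>A. F)"
    by (intro sum_mono count_le_F[OF assms(2)]) (simp add: A_edge)
  also have "\<dots> = card A * F" by simp
  also have "card A \<le> 2 * length es"
  proof -
    have "card A = card (earc ` A)" by (intro card_image[symmetric] inj_onI) simp
    also have "\<dots> \<le> length (arc_list x)" unfolding set_arc_list[symmetric] by (rule card_length)
    also have "length (arc_list x) = 2 * length es"
      unfolding arc_list_def fld_x lst_enc_list by (simp add: length_concat comp_def sum_list_triv)
    finally show ?thesis .
  qed
  finally show ?thesis by (simp add: mult.commute mult.left_commute)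
qed

text \<open>An arc at \<open>v\<close> is determined by its edge and by whether it leaves
  \<open>v\<close>, hence the factor 2.\<close>

lemma card_inc:
  assumes v: "v \<in> V"
  shows "card (inc v) \<le> 2 * \<Delta>"
proof -
  have "inj_on (\<lambda>a. (edge_of a, fst a = v)) (inc v)"
  proof (rule inj_onI)
    fix a b assume "a \<in> inc v" "b \<in> inc v" "(edge_of a, fst a = v) = (edge_of b, fst b = v)"
    then show "a = b"
      using A_in unfolding inc_def prod.inject edge_of_eq in_edge_of by (cases a; cases b) auto
  qed
  moreover have "(\<lambda>a. (edge_of a, fst a = v)) ` inc v \<subseteq> {e \<in> E. v \<in> e} \<times> UNIV"
    by (auto simp: inc_def A_edge)
  ultimately have "card (inc v) \<le> card ({e \<in> E. v \<in> e} \<times> (UNIV :: bool set))"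
    using finite_E by (intro card_inj_on_le) auto
  also have "\<dots> \<le> 2 * \<Delta>" using deg[OF v] by (simp add: card_cartesian_product degree_in_def)
  finally show ?thesis .
qed

text \<open>The origin of \<open>2 * F * \<Delta>\<close>: at most \<open>2 * \<Delta>\<close> arcs
  touch \<open>v\<close>, and each occupies at most \<open>F\<close> positions.\<close>

lemma view_nonblank:
  assumes v: "v \<in> V" and w: "set w \<subseteq> A" "\<forall>e\<in>E. counts_ok w e"
  shows "card {i. i < length w \<and> map (view v) w ! i \<noteq> NIL} \<le> 2 * F * \<Delta>"
proof -
  have fin: "finite (inc v)"
    using finite_A by (rule finite_subset[rotated]) (auto simp: inc_def)
  have "{i. i < length w \<and> map (view v) w ! i \<noteq> NIL} \<subseteq> (\<Union>a\<in>inc v. {i. i < length w \<and> w ! i = a})"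
    using w(1) nth_mem by (fastforce simp: view_simps inc_def)
  then have "card {i. i < length w \<and> map (view v) w ! i \<noteq> NIL} \<le>
    card (\<Union>a\<in>inc v. {i. i < length w \<and> w ! i = a})"
    by (intro card_mono finite_UN_I fin) auto
  also have "\<dots> \<le> (\<Sum>a\<in>inc v. card {i. i < length w \<and> w ! i = a})" by (rule card_UN_le[OF fin])
  also have "\<dots> \<le> (\<Sum>a\<in>inc v. F)"
  proof (rule sum_mono)
    fix a assume "a \<in> inc v"
    then have a: "edge_of a \<in> E" by (simp add: inc_def A_edge)
    have "card {i. i < length w \<and> w ! i = a} = length (filter (\<lambda>b. b = a) w)"
      by (simp add: length_filter_conv_card)
    also have "\<dots> = count_list w a" by (induction w) auto
    also have "\<dots> \<le> F" by (rule count_le_F[OF w(2) a])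
    finally show "card {i. i < length w \<and> w ! i = a} \<le> F" .
  qed
  also have "\<dots> \<le> 2 * F * \<Delta>" using card_inc[OF v] by (simp add: mult.commute mult.left_commute)
  finally show ?thesis .
qed

theorem decide_iff: "decide F (2 * F * \<Delta>) x \<longleftrightarrow> (\<exists>w. vehicle_route V E d p L c t f w)"
proof -
  have rl: "rat_le l (enc_rat 1) (fld 3 x) \<longleftrightarrow> of_nat l \<le> L" for l
    unfolding fld_x rat_le_enc_rat by (auto intro: order_trans[OF of_nat_0_le_iff])
  let ?K = "2 * F * \<Delta>"
  show ?thesis
  proof
    assume "decide F ?K x"
    then obtain l where l: "of_nat l \<le> L" "accept x ?K l" unfolding decide_def rl by blast
    have L: "0 \<le> L" using l(1) by (rule order_trans[OF of_nat_0_le_iff])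
    from accept_family[OF l(2)] obtain Y where
      Y: "\<And>v. v \<in> V \<Longrightarrow> Y v \<in> set (ws ?K l 0 v)"
        "\<And>u v. (u, v) \<in> A \<Longrightarrow> agree (enc_nat u) (enc_nat v) l (nthd (lst (Y u))) (nthd (lst (Y v)))"
      by blast
    have loc: "local_ok x l (enc_nat v) (Y v)" "length (lst (Y v)) = l"
      "\<And>i. i < l \<Longrightarrow> nthd (lst (Y v)) i = NIL \<or> nthd (lst (Y v)) i \<in> earc ` inc v" if "v \<in> V" for v
      using Y(1)[OF that] words_sound[of "Y v" v l ?K] by auto
    obtain w where w: "length w = l" "set w \<subseteq> A" "pcas d w d"
      "\<And>v i. v \<in> V \<Longrightarrow> i < l \<Longrightarrow> nthd (lst (Y v)) i = view v (w ! i)"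
    proof (rule family_walk[of l "\<lambda>v. nthd (lst (Y v))"])
      show "chain_ok (enc_nat d) (enc_nat v) l (nthd (lst (Y v)))" if "v \<in> V" for v
        using loc(1)[OF that] unfolding local_ok_def fld_x by blast
    qed (use loc(3) Y(2) in blast)+
    have yv: "lst (Y v) = map (view v) w" if "v \<in> V" for v
      using w(1) loc(2)[OF that] w(4)[OF that] by (intro nth_equalityI) auto
    have ok: "(\<forall>e\<in>E. v \<in> e \<longrightarrow> counts_ok w e \<and> gaps_ok w e) \<and> (v = d \<longrightarrow> windows_ok w)" if "v \<in> V" for v
      using loc(1)[OF that] local_ok_view[OF L yv[OF that]] w(1) by blast
    \<comment> \<open>Each edge is tested by the view of an endpoint, here the tail of the arc
      listed for it.\<close>
    have "counts_ok w e \<and> gaps_ok w e" if e: "e \<in> E" for e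
    proof -
      from e es(2) obtain a where "e = edge_of a" by auto
      then have "fst a \<in> V" "fst a \<in> e" using e A_in[of a] by (auto simp: A_edge in_edge_of)
      with ok e show ?thesis by blast
    qed
    with ok[OF d] w l(1) have "vehicle_route V E d p L c t f w" unfolding vehicle_route_iff by blast
    then show "\<exists>w. vehicle_route V E d p L c t f w" ..
  next
    assume "\<exists>w. vehicle_route V E d p L c t f w"
    then obtain w where w: "set w \<subseteq> A" "pcas d w d" "of_nat (length w) \<le> L"
      "\<forall>e\<in>E. counts_ok w e \<and> gaps_ok w e" "windows_ok w"
      unfolding vehicle_route_iff by blast
    have L: "0 \<le> L" using w(3) by (rule order_trans[OF of_nat_0_le_iff])
    let ?Y = "\<lambda>v. enc_list (map (view v) w)"
    \<comment> \<open>The views of a route agree with one another, so each protects its neighbours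
      and none is discarded in any round.\<close>
    have "?Y v \<in> set (ws ?K (length w) n v)" if "v \<in> V" for v n
      using that
    proof (induction n arbitrary: v)
      case 0
      have "?Y v \<in> set (words x (enc_nat v) (length w) ?K)"
      proof (rule words_complete)
        show "\<forall>i<length w. map (view v) w ! i = NIL \<or> map (view v) w ! i \<in> earc ` inc v"
        proof (intro allI impI)
          fix i assume i: "i < length w"
          then have "w ! i \<in> A" using w(1) by auto
          with i show "map (view v) w ! i = NIL \<or> map (view v) w ! i \<in> earc ` inc v"
            by (auto simp: view_def inc_def)
        qed
      qed (use view_nonblank[OF 0 w(1)] w(4) in auto)
      moreover have "local_ok x (length w) (enc_nat v) (?Y v)"
        unfolding local_ok_view[OF L lst_enc_list]
        using w by (auto intro: chain_view)
      ultimately show ?case by simp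
    next
      case (Suc n)
      have "agree (enc_nat v) (enc_nat u) (length w) (nthd (lst (?Y v))) (nthd (lst (?Y u)))" for u
        unfolding agree_def earc_simps lst_enc_list
      proof (intro allI impI)
        fix i assume i: "i < length w"
          "nthd (map (view v) w) i = earc (v, u) \<or> nthd (map (view v) w) i = earc (u, v) \<or>
           nthd (map (view u) w) i = earc (v, u) \<or> nthd (map (view u) w) i = earc (u, v)"
        then have "w ! i = (v, u) \<or> w ! i = (u, v)" by (auto simp: view_simps)
        with i(1) show "nthd (map (view v) w) i = nthd (map (view u) w) i"
          by (auto simp: view_def)
      qed
      moreover have "?Y u \<in> set (ws ?K (length w) n u)" if "u \<in> V" for u by (rule Suc.IH[OF that])
      ultimately show ?case
        using Suc.IH[OF Suc.prems] unfolding ws.simps set_filter by blast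
    qed
    then have "accept x ?K (length w)" unfolding accept_iff by (metis list.set(1) empty_iff)
    moreover have "length w < 2 * F * length (lst (fld 1 x)) + 1"
      using length_route[OF w(1)] w(4) unfolding fld_x lst_enc_list length_map by (auto simp: less_Suc_eq_le)
    ultimately show "decide F ?K x" unfolding decide_def rl using w(3) by blast
  qed
qed

end

theorem theorem13:
  fixes z \<Delta> F :: nat
  shows "poly_time_decidable
    {(x, \<exists>w. vehicle_route V E d p L c t f w) | x V E d p L c t f.
       maintaining_plan V E d z p \<and> undirected_tree V E \<and>
       (\<forall>v\<in>V. degree_in E v \<le> \<Delta>) \<and>
       (\<forall>e\<in>E. f e \<le> F) \<and>
       c \<le> 1 \<and>
       (\<forall>k\<in>{1..z}. \<forall>i\<ge>1. t k i > 0) \<and>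
       encodes z F x V E d p L c t f}"
proof (rule poly_time_decidableI[OF pbool_decide])
  fix x b
  assume "(x, b) \<in> {(x, \<exists>w. vehicle_route V E d p L c t f w) | x V E d p L c t f.
       maintaining_plan V E d z p \<and> undirected_tree V E \<and>
       (\<forall>v\<in>V. degree_in E v \<le> \<Delta>) \<and>
       (\<forall>e\<in>E. f e \<le> F) \<and>
       c \<le> 1 \<and>
       (\<forall>k\<in>{1..z}. \<forall>i\<ge>1. t k i > 0) \<and>
       encodes z F x V E d p L c t f}"
  then obtain V E d p L c t f where b: "b = (\<exists>w. vehicle_route V E d p L c t f w)"
    and plan: "maintaining_plan V E d z p" "undirected_tree V E" "\<forall>v\<in>V. degree_in E v \<le> \<Delta>"
      "\<forall>e\<in>E. f e \<le> F" "\<forall>k\<in>{1..z}. \<forall>i\<ge>1. t k i > 0" "encodes z F x V E d p L c t f"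
    by blast
  from plan(6) obtain vs es where enc: "distinct vs" "set vs = V"
    "distinct (map edge_of es)" "set (map edge_of es) = E"
    "x = enc_list
          [enc_list (map enc_nat vs),
           enc_list (map (\<lambda>(u, v). enc_list
             [enc_nat u, enc_nat v, enc_nat (p {u, v}), enc_nat (f {u, v})]) es),
           enc_nat d,
           enc_rat L,
           enc_rat c,
           enc_list (map (\<lambda>k. enc_list (map (\<lambda>i. enc_rat (t k i)) [1..<2 * F])) [1..<z + 1])]"
    unfolding encodes_def by blast
  have "encoded_instance z \<Delta> F V E d p L c t f x vs es"
    using plan(1-5) enc unfolding maintaining_plan_def by (intro encoded_instance.intro) blast+
  from encoded_instance.decide_iff[OF this] show "b \<longleftrightarrow> decide F (2 * F * \<Delta>) x"
    unfolding b by simp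
qed

end
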